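(* Consider an indeterminate normalized Hamburger moment problem with moments $(s_n)$ and order $\rho$. Let $P_n(x)=\sum_{k=0}^nb_{k,n}x^k$ be the orthonormal polynomials, $c_k=(\sum_{n=k}^\infty b_{k,n}^2)^{1/2}$, and $$L(z)=\sum_{n=0}^\infty\frac{z^n}{\sqrt{s_{2n}}},\qquad H(z)=\sum_{n=0}^\infty b_{n,n}z^n,\qquad \Phi(z)=\sum_{n=0}^\infty c_nz^n$$ (all entire functions). Then: (i) $1\le s_{2n}b_{n,n}^2\le c_n^2s_{2n}$ for all $n\ge0$. (ii) $M_L(r)\le M_H(r)\le M_\Phi(r)$ for $r\ge0$. (iii) $\rho_L\le\rho_H\le\rho_\Phi=\rho$. (iv) $\rho^{[1]}_L\le\rho^{[1]}_H\le\rho^{[1]}_\Phi=\rho^{[1]}$, provided $\rho=0$. (v) $\rho^{[2]}_L\le\rho^{[2]}_H\le\rho^{[2]}_\Phi=\rho^{[2]}$, provided $\rho^{[1]}=0$. Here $\rho,\rho^{[1]},\rho^{[2]}$ without subscript denote the order, logarithmic order and double logarithmic order of the moment problem.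
   Context: A normalized Hamburger moment problem is given by a sequence $s_n=\int_{-\infty}^\infty x^n\,d\mu(x)$, $n\ge0$, where $\mu$ is a probability measure on $\mathbb R$ with infinite support and moments of every order. It is indeterminate if more than one measure $\mu$ has these moments. The orthonormal polynomials $P_n$ have positive leading coefficients $b_{n,n}$. Put $P(z)=(\sum_{n\ge0}|P_n(z)|^2)^{1/2}$; in the indeterminate case $P$ is finite and continuous on $\mathbb C$, the $c_k$ are finite, and it is known that $\lim_k k\,c_k^{1/k}=0$. For an unbounded continuous $f:\mathbb C\to\mathbb C$ let $M_f(r)=\max_{|z|\le r}|f(z)|$, and define (each with $\inf\emptyset=\infty$, "large" meaning sufficiently large) order: $\rho_f=\inf\{a>0\mid \log M_f(r)\le r^a\text{ for all large }r\}$; logarithmic order: $\rho^{[1]}_f=\inf\{a>0\mid M_f(r)\le r^{(\log r)^a}\text{ for all large }r\}$; double logarithmic order: $\rho^{[2]}_f=\inf\{a>0\mid M_f(r)\le r^{(\log\log r)^a}\text{ for all large }r\}$. The order $\rho$, logarithmic order $\rho^{[1]}$ and double logarithmic order $\rho^{[2]}$ of an indeterminate moment problem are those of $P$ (the function $(\sum_n|Q_n(z)|^2)^{1/2}$, with $Q_n$ the polynomials of the second kind, and the four entire Nevanlinna functions $A,B,C,D$ give the same values). *)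

theory Defs
  imports
    "HOL-Probability.Probability"
    "HOL-Computational_Algebra.Polynomial"
begin

definition measure_support :: "real measure \<Rightarrow> real set" where
  "measure_support \<mu> = {x. \<forall>U. open U \<longrightarrow> x \<in> U \<longrightarrow> 0 < emeasure \<mu> U}"

text \<open>Integrability for \<open>n = 0\<close> makes every such \<open>\<mu>\<close> a finite measure.\<close>

definition has_moments :: "real measure \<Rightarrow> (nat \<Rightarrow> real) \<Rightarrow> bool" where
  "has_moments \<mu> s \<longleftrightarrow>
     sets \<mu> = sets borel \<and>
     (\<forall>n. integrable \<mu> (\<lambda>x. x ^ n) \<and> (\<integral>x. x ^ n \<partial>\<mu>) = s n)"

definition indeterminate :: "(nat \<Rightarrow> real) \<Rightarrow> bool" where
  "indeterminate s \<longleftrightarrow> (\<exists>\<mu> \<nu>. has_moments \<mu> s \<and> has_moments \<nu> s \<and> \<mu> \<noteq> \<nu>)"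

text \<open>The products are integrable as soon as \<open>\<mu>\<close> has moments of all orders, and the integrals
  only depend on these moments; the conditions determine \<open>p\<close> uniquely.\<close>

definition orthonormal_polynomials :: "real measure \<Rightarrow> (nat \<Rightarrow> real poly) \<Rightarrow> bool" where
  "orthonormal_polynomials \<mu> p \<longleftrightarrow>
     (\<forall>n. degree (p n) = n \<and> 0 < lead_coeff (p n)) \<and>
     (\<forall>m n. (\<integral>x. poly (p m) x * poly (p n) x \<partial>\<mu>) = (if m = n then 1 else 0))"

text \<open>In terms of the sequence \<open>p\<close>, the number \<open>b\<^sub>k\<^sub>,\<^sub>n\<close> is \<open>coeff (p n) k\<close>.\<close>

definition cseq :: "(nat \<Rightarrow> real poly) \<Rightarrow> nat \<Rightarrow> real" where
  "cseq p k = sqrt (\<Sum>i. (coeff (p (k + i)) k)\<^sup>2)"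

text \<open>The real-valued function \<open>P\<close>, regarded as a complex-valued one.\<close>

definition Pfun :: "(nat \<Rightarrow> real poly) \<Rightarrow> complex \<Rightarrow> complex" where
  "Pfun p z = of_real (sqrt (\<Sum>n. (cmod (poly (map_poly of_real (p n)) z))\<^sup>2))"

definition Lfun :: "(nat \<Rightarrow> real) \<Rightarrow> complex \<Rightarrow> complex" where
  "Lfun s z = (\<Sum>n. z ^ n / of_real (sqrt (s (2 * n))))"

definition Hfun :: "(nat \<Rightarrow> real poly) \<Rightarrow> complex \<Rightarrow> complex" where
  "Hfun p z = (\<Sum>n. of_real (coeff (p n) n) * z ^ n)"

definition Phifun :: "(nat \<Rightarrow> real poly) \<Rightarrow> complex \<Rightarrow> complex" where
  "Phifun p z = (\<Sum>n. of_real (cseq p n) * z ^ n)"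

definition max_modulus :: "(complex \<Rightarrow> complex) \<Rightarrow> real \<Rightarrow> real" where
  "max_modulus f r = (SUP z\<in>cball 0 r. cmod (f z))"

text \<open>The infima are taken in the extended reals, where the infimum of the empty set is \<open>\<infinity>\<close>.\<close>

definition growth_order :: "(complex \<Rightarrow> complex) \<Rightarrow> ereal" where
  "growth_order f =
     Inf {ereal a | a. 0 < a \<and> (\<forall>\<^sub>F r in at_top. ln (max_modulus f r) \<le> r powr a)}"

definition log_order :: "(complex \<Rightarrow> complex) \<Rightarrow> ereal" where
  "log_order f =
     Inf {ereal a | a. 0 < a \<and> (\<forall>\<^sub>F r in at_top. max_modulus f r \<le> r powr (ln r powr a))}"

definition double_log_order :: "(complex \<Rightarrow> complex) \<Rightarrow> ereal" where
  "double_log_order f =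
     Inf {ereal a | a. 0 < a \<and> (\<forall>\<^sub>F r in at_top. max_modulus f r \<le> r powr (ln (ln r) powr a))}"

text \<open>The orders of the moment problem, given through its orthonormal polynomials.\<close>

definition problem_order :: "(nat \<Rightarrow> real poly) \<Rightarrow> ereal" where
  "problem_order p = growth_order (Pfun p)"

definition problem_log_order :: "(nat \<Rightarrow> real poly) \<Rightarrow> ereal" where
  "problem_log_order p = log_order (Pfun p)"

definition problem_double_log_order :: "(nat \<Rightarrow> real poly) \<Rightarrow> ereal" where
  "problem_double_log_order p = double_log_order (Pfun p)"

end

theory Submission
  imports Defs "HOL-Complex_Analysis.Complex_Analysis" "HOL-Real_Asymp.Real_Asymp"
begin

text \<open>
  If \<open>\<mu>\<close> and \<open>\<nu>\<close> have the same moments, then for every polynomial \<open>q\<close> the quotient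
  \<open>(q(x) - q(z)) / (x - z)\<close> has the same integral against both, so that \<open>q(z)\<close> times the difference of
  the Stieltjes transforms at \<open>z\<close> is the difference of the integrals of \<open>q(x) / (x - z)\<close>. If
  \<open>\<mu> \<noteq> \<nu>\<close>, the transforms differ at some non-real \<open>z\<^sub>0\<close>, and Bessel's inequality gives
  \<open>\<Sum>\<^sub>n |P\<^sub>n(z\<^sub>0)|\<^sup>2 < \<infinity>\<close>. Expanding \<open>(P\<^sub>n(z) - P\<^sub>n(z\<^sub>0)) / (z - z\<^sub>0)\<close> in the \<open>P\<^sub>k\<close> yields a
  discrete Volterra equation with square summable kernel, and a Gronwall argument carries the
  convergence over to all \<open>z\<close>, locally uniformly.

  Minkowski's inequality in \<open>\<ell>\<^sup>2\<close> gives \<open>P(z) \<le> \<Phi>(|z|)\<close>, while Cauchy's estimate gives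
  \<open>c\<^sub>k r\<^sup>k \<le> M\<^sub>P(r)\<close> and hence \<open>\<Phi>(r) \<le> 2 M\<^sub>P(2r)\<close>. None of the three orders sees the factors \<open>2\<close>.
  The rest is the comparison of coefficients \<open>1 / sqrt s\<^sub>2\<^sub>n \<le> b\<^sub>n\<^sub>,\<^sub>n \<le> c\<^sub>n\<close>, the first inequality being
  Bessel's inequality for \<open>x\<^sup>n\<close>.
\<close>

section \<open>Injectivity of the Stieltjes transform\<close>

text \<open>The mean value theorem puts the increment at an intermediate point \<open>\<xi>\<close>,
  and the derivative 1/(1 + u^2) is Lipschitz with constant 1. The error bound does not involve
  \<open>u\<close>, so it survives integration over a shift of \<open>u\<close>.\<close>

lemma arctan_linearization_error:
  fixes u d :: real
  shows "\<bar>arctan (u + d) - arctan u - d / (1 + u\<^sup>2)\<bar> \<le> d\<^sup>2"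
proof -
  obtain \<xi> where \<xi>: "arctan (u + d) - arctan u = d * (1 / (1 + \<xi>\<^sup>2))" "\<bar>u - \<xi>\<bar> \<le> \<bar>d\<bar>"
  proof (cases "d = 0")
    case False
    \<comment> \<open>The mean value theorem wants ordered endpoints; minimum and maximum treat both
      signs of \<open>d\<close> at once.\<close>
    define a b where "a = min u (u + d)" and "b = max u (u + d)"
    have "a < b" using False by (auto simp: a_def b_def)
    then obtain z where z: "a < z" "z < b" "arctan b - arctan a = (b - a) * inverse (1 + z\<^sup>2)"
      using MVT2[of a b arctan "\<lambda>x. inverse (1 + x\<^sup>2)"] DERIV_arctan by blast
    from z have "arctan (u + d) - arctan u = d * (1 / (1 + z\<^sup>2))"
      by (cases "d > 0") (auto simp: a_def b_def min_def max_def field_simps split: if_splits)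
    with z that[of z] show ?thesis by (auto simp: a_def b_def)
  qed (use that in auto)
  have p: "1 + u\<^sup>2 > 0" "1 + \<xi>\<^sup>2 > 0" by (auto simp: add_pos_nonneg)
  have "\<bar>u + \<xi>\<bar> \<le> (1 + u\<^sup>2) * (1 + \<xi>\<^sup>2)"
  proof -
    have "2 * \<bar>u\<bar> \<le> 1 + u\<^sup>2" "2 * \<bar>\<xi>\<bar> \<le> 1 + \<xi>\<^sup>2"
      using sum_squares_bound[of 1 "\<bar>u\<bar>"] sum_squares_bound[of 1 "\<bar>\<xi>\<bar>"] by auto
    moreover have "0 \<le> u\<^sup>2 * \<xi>\<^sup>2" by simp
    moreover have "(1 + u\<^sup>2) * (1 + \<xi>\<^sup>2) = 1 + u\<^sup>2 + \<xi>\<^sup>2 + u\<^sup>2 * \<xi>\<^sup>2" by (simp add: algebra_simps)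
    moreover have "\<bar>u + \<xi>\<bar> \<le> \<bar>u\<bar> + \<bar>\<xi>\<bar>" by simp
    moreover have "0 \<le> u\<^sup>2" "0 \<le> \<xi>\<^sup>2" by auto
    ultimately show ?thesis by linarith
  qed
  then have k: "\<bar>u + \<xi>\<bar> / ((1 + u\<^sup>2) * (1 + \<xi>\<^sup>2)) \<le> 1" using p by simp
  have "1 / (1 + \<xi>\<^sup>2) - 1 / (1 + u\<^sup>2) = (u - \<xi>) * (u + \<xi>) / ((1 + u\<^sup>2) * (1 + \<xi>\<^sup>2))"
    using p by (simp add: field_simps power2_eq_square)
  then have "\<bar>1 / (1 + \<xi>\<^sup>2) - 1 / (1 + u\<^sup>2)\<bar> = \<bar>u - \<xi>\<bar> * (\<bar>u + \<xi>\<bar> / ((1 + u\<^sup>2) * (1 + \<xi>\<^sup>2)))"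
    using p by (simp add: abs_mult)
  also have "\<dots> \<le> \<bar>d\<bar> * 1" by (intro mult_mono \<xi> k) auto
  finally have "\<bar>d\<bar> * \<bar>1 / (1 + \<xi>\<^sup>2) - 1 / (1 + u\<^sup>2)\<bar> \<le> \<bar>d\<bar> * \<bar>d\<bar>" by (intro mult_left_mono) auto
  moreover have "arctan (u + d) - arctan u - d / (1 + u\<^sup>2) = d * (1 / (1 + \<xi>\<^sup>2) - 1 / (1 + u\<^sup>2))"
    unfolding \<xi>(1) by (simp add: right_diff_distrib)
  ultimately show ?thesis by (simp add: abs_mult power2_eq_square)
qed

lemma has_field_derivative_0I:
  fixes f :: "real \<Rightarrow> real"
  assumes "\<And>h. \<bar>f (t + h) - f t\<bar> \<le> C * h\<^sup>2"
  shows "(f has_field_derivative 0) (at t)"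
proof -
  have "((\<lambda>h. (f (t + h) - f t) / h) \<longlongrightarrow> 0) (at 0)"
  proof (rule Lim_null_comparison)
    have "norm ((f (t + h) - f t) / h) \<le> C * \<bar>h\<bar>" if "h \<noteq> 0" for h
      using assms[of h] that by (simp add: field_simps power2_eq_square)
    then show "\<forall>\<^sub>F h in at 0. norm ((f (t + h) - f t) / h) \<le> C * \<bar>h\<bar>"
      by (auto simp: eventually_at_filter)
    have "((\<lambda>h. C * \<bar>h\<bar>) \<longlongrightarrow> C * \<bar>0\<bar>) (at (0::real))" by (intro tendsto_intros)
    then show "((\<lambda>h. C * \<bar>h\<bar>) \<longlongrightarrow> 0) (at (0::real))" by simp
  qed
  then show ?thesis by (simp add: DERIV_def)
qed

lemma abs_arctan_bound: "\<bar>arctan x\<bar> * 2 \<le> pi"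
  using arctan_bounded[of x] by linarith

text \<open>With this sign, the imaginary part at t + iy, y > 0, is pi times the Poisson smoothing
  of \<open>M\<close>.\<close>

definition stieltjes :: "real measure \<Rightarrow> complex \<Rightarrow> complex" where
  "stieltjes M z = (\<integral>x. 1 / (of_real x - z) \<partial>M)"

lemma norm_resolvent_le:
  assumes "Im z \<noteq> 0"
  shows "cmod (1 / (of_real x - z)) \<le> 1 / \<bar>Im z\<bar>"
proof -
  have "\<bar>Im z\<bar> \<le> cmod (of_real x - z)" using abs_Im_le_cmod[of "of_real x - z"] by simp
  then show ?thesis using assms by (simp add: norm_divide frac_le)
qed

lemma borel_measurable_resolvent:
  assumes "Im z \<noteq> 0"
  shows "(\<lambda>x. 1 / (complex_of_real x - z)) \<in> borel_measurable borel"
  using assms by (intro borel_measurable_continuous_onI continuous_intros) (auto simp: complex_eq_iff)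

context real_distribution
begin

lemma integrable_resolvent:
  assumes "Im z \<noteq> 0"
  shows "integrable M (\<lambda>x. 1 / (complex_of_real x - z))"
  using borel_measurable_resolvent[OF assms] norm_resolvent_le[OF assms]
  by (intro integrable_const_bound[where B = "1 / \<bar>Im z\<bar>"]) (auto cong: measurable_cong_sets)

lemma integrable_arctan: "integrable M (\<lambda>x. arctan ((t - x) / y))"
  by (intro integrable_const_bound[where B = "pi / 2"]) (auto simp: abs_arctan_bound)

text \<open>The derivative of arctan((t - x)/y) in t is y/((x - t)^2 + y^2), the imaginary part of
  the resolvent at t + iy. So the arctangent integral is a primitive of the imaginary part of the
  transform along a horizontal line. The uniform quadratic error, taken at increment h/y, replaces
  differentiation under the integral.\<close>

lemma arctan_integral_increment:
  assumes y: "y > 0"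
  shows "\<bar>(\<integral>x. arctan ((t + h - x) / y) \<partial>M) - (\<integral>x. arctan ((t - x) / y) \<partial>M)
           - h * Im (stieltjes M (Complex t y))\<bar> \<le> h\<^sup>2 / y\<^sup>2"
proof -
  define K where "K = (\<lambda>x. Im (1 / (complex_of_real x - Complex t y)))"
  have Im: "Im (stieltjes M (Complex t y)) = (\<integral>x. K x \<partial>M)"
    unfolding stieltjes_def K_def using y by (intro integral_Im[symmetric] integrable_resolvent) auto
  have iK: "integrable M K"
    unfolding K_def using y by (intro integrable_Im integrable_resolvent) auto
  define E where "E = (\<lambda>x. arctan ((t + h - x) / y) - arctan ((t - x) / y) - h * K x)"
  have iE: "integrable M E"
    unfolding E_def
    by (intro Bochner_Integration.integrable_diff integrable_arctan integrable_mult_right iK)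
  have pw: "\<bar>E x\<bar> \<le> h\<^sup>2 / y\<^sup>2" for x
  proof -
    have "K x = y / ((x - t)\<^sup>2 + y\<^sup>2)"
      by (simp add: K_def Im_divide)
    also have "\<dots> = (1 / y) / (1 + ((t - x) / y)\<^sup>2)"
      using y by (simp add: field_simps power2_eq_square)
    finally have "h * K x = (h / y) / (1 + ((t - x) / y)\<^sup>2)" by simp
    moreover have "(t + h - x) / y = (t - x) / y + h / y" by (simp add: add_divide_distrib diff_divide_distrib)
    ultimately show ?thesis
      using arctan_linearization_error[of "(t - x) / y" "h / y"] by (simp add: E_def power_divide)
  qed
  have "(\<integral>x. arctan ((t + h - x) / y) \<partial>M) - (\<integral>x. arctan ((t - x) / y) \<partial>M) - h * Im (stieltjes M (Complex t y))
      = (\<integral>x. E x \<partial>M)"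
    unfolding Im E_def using integrable_arctan iK by simp
  also have "\<bar>\<dots>\<bar> \<le> (\<integral>x. h\<^sup>2 / y\<^sup>2 \<partial>M)"
    by (rule integral_abs_bound_integral) (use iE pw in auto)
  also have "\<dots> = h\<^sup>2 / y\<^sup>2" using prob_space by simp
  finally show ?thesis .
qed

text \<open>This fixes the constant of integration: the limit is the same for every probability
  measure.\<close>

lemma arctan_integral_at_bot:
  assumes y: "y > 0"
  shows "(\<lambda>n. \<integral>x. arctan ((- real n - x) / y) \<partial>M) \<longlonglongrightarrow> - pi / 2"
proof -
  have "(\<lambda>n. \<integral>x. arctan ((- real n - x) / y) \<partial>M) \<longlonglongrightarrow> (\<integral>x. - pi / 2 \<partial>M)"
  proof (rule integral_dominated_convergence[where w = "\<lambda>_. pi / 2"])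
    have "filterlim (\<lambda>n. (- real n - x) / y) at_bot sequentially" for x
      using y by real_asymp
    then show "AE x in M. (\<lambda>n. arctan ((- real n - x) / y)) \<longlonglongrightarrow> - pi / 2"
      using filterlim_compose[OF tendsto_arctan_at_bot] by auto
  qed (auto simp: abs_arctan_bound)
  then show ?thesis using prob_space by simp
qed

text \<open>Shifting the arctangent by \<open>1 / (n + 1)\<close> and sharpening it at the faster rate \<open>1 / (n + 1)\<^sup>2\<close>
  makes the limit a step function that is right on the boundary point \<open>t\<close> as well.\<close>

lemma arctan_integral_cdf:
  "(\<lambda>n. \<integral>x. arctan ((t + 1 / real (Suc n) - x) / (1 / (real (Suc n))\<^sup>2)) \<partial>M)
     \<longlonglongrightarrow> pi * cdf M t - pi / 2"
proof -
  have "(\<lambda>n. \<integral>x. arctan ((t + 1 / real (Suc n) - x) / (1 / (real (Suc n))\<^sup>2)) \<partial>M)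
     \<longlonglongrightarrow> (\<integral>x. pi * indicator {..t} x - pi / 2 \<partial>M)"
  proof (rule integral_dominated_convergence[where w = "\<lambda>_. pi / 2"])
    have "(\<lambda>n. arctan ((t + 1 / real (Suc n) - x) / (1 / (real (Suc n))\<^sup>2)))
       \<longlonglongrightarrow> pi * indicator {..t} x - pi / 2" for x
    proof (cases "x \<le> t")
      case True
      then have "0 \<le> t - x" by simp
      have "filterlim (\<lambda>n. (t + 1 / real (Suc n) - x) / (1 / (real (Suc n))\<^sup>2)) at_top sequentially"
      proof (rule filterlim_at_top_mono)
        show "filterlim (\<lambda>n. real (Suc n)) at_top sequentially" by real_asymp
        have "real (Suc n) \<le> (t + 1 / real (Suc n) - x) / (1 / (real (Suc n))\<^sup>2)" for n
        proof -
          have "0 \<le> (t - x) * (real (Suc n))\<^sup>2" using \<open>0 \<le> t - x\<close> by simp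
          then show ?thesis by (simp add: field_simps power2_eq_square del: of_nat_Suc)
        qed
        then show "\<forall>\<^sub>F n in sequentially. real (Suc n) \<le> (t + 1 / real (Suc n) - x) / (1 / (real (Suc n))\<^sup>2)"
          by simp
      qed
      then show ?thesis using filterlim_compose[OF tendsto_arctan_at_top] True by auto
    next
      case False
      then have "t - x < 0" by simp
      then have "filterlim (\<lambda>n. (t - x + 1 / real (Suc n)) / (1 / (real (Suc n))\<^sup>2)) at_bot sequentially"
        by real_asymp
      moreover have "(\<lambda>n. (t - x + 1 / real (Suc n)) / (1 / (real (Suc n))\<^sup>2)) =
         (\<lambda>n. (t + 1 / real (Suc n) - x) / (1 / (real (Suc n))\<^sup>2))" by (simp add: algebra_simps)
      ultimately show ?thesis using filterlim_compose[OF tendsto_arctan_at_bot] False by auto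
    qed
    then show "AE x in M. (\<lambda>n. arctan ((t + 1 / real (Suc n) - x) / (1 / (real (Suc n))\<^sup>2)))
       \<longlonglongrightarrow> pi * indicator {..t} x - pi / 2" by auto
  qed (auto simp: abs_arctan_bound)
  also have "(\<integral>x. pi * indicator {..t} x - pi / 2 \<partial>M) = pi * cdf M t - pi / 2"
    using prob_space by (subst Bochner_Integration.integral_diff) (auto simp: cdf_def emeasure_eq_measure)
  finally show ?thesis .
qed

end

text \<open>On each line Im z = y the two arctangent integrals have equal derivatives and equal
  limits at minus infinity, so they coincide. Letting y tend to 0 turns arctangents into steps and
  recovers the distribution functions.\<close>

lemma stieltjes_unique:
  assumes M: "real_distribution M" and N: "real_distribution N"
    and eq: "\<And>z. Im z > 0 \<Longrightarrow> stieltjes M z = stieltjes N z"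
  shows "M = N"
proof (rule cdf_unique[OF M N])
  interpret M: real_distribution M by fact
  interpret N: real_distribution N by fact
  define G where "G = (\<lambda>y t. (\<integral>x. arctan ((t - x) / y) \<partial>M) - (\<integral>x. arctan ((t - x) / y) \<partial>N))"
  have G0: "G y t = 0" if y: "y > 0" for y t
  proof -
    \<comment> \<open>The linear terms cancel because the transforms agree; each measure contributes
      one error h^2/y^2.\<close>
    have "\<bar>G y (t + h) - G y t\<bar> \<le> (2 / y\<^sup>2) * h\<^sup>2" for t h
    proof -
      have "stieltjes M (Complex t y) = stieltjes N (Complex t y)" using eq y by simp
      then show ?thesis
        using M.arctan_integral_increment[OF y, of t h] N.arctan_integral_increment[OF y, of t h]
        unfolding G_def by (simp add: algebra_simps)
    qed
    then have const: "G y t = G y t'" for t t'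
      by (intro DERIV_isconst_all allI has_field_derivative_0I)
    have "(\<lambda>n. G y (- real n)) \<longlonglongrightarrow> - pi / 2 - - pi / 2"
      unfolding G_def by (intro tendsto_diff M.arctan_integral_at_bot N.arctan_integral_at_bot y)
    moreover have "(\<lambda>n. G y (- real n)) = (\<lambda>n. G y t)" using const by blast
    ultimately show ?thesis by (simp add: LIMSEQ_const_iff)
  qed
  have "cdf M t = cdf N t" for t
  proof -
    \<comment> \<open>Height and abscissa follow the limit in \<open>arctan_integral_cdf\<close>;
      \<open>G\<close> vanishes all along this sequence.\<close>
    have "(\<lambda>n. G (1 / (real (Suc n))\<^sup>2) (t + 1 / real (Suc n)))
        \<longlonglongrightarrow> (pi * cdf M t - pi / 2) - (pi * cdf N t - pi / 2)"
      unfolding G_def by (intro tendsto_diff M.arctan_integral_cdf N.arctan_integral_cdf)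
    moreover have "(\<lambda>n. G (1 / (real (Suc n))\<^sup>2) (t + 1 / real (Suc n))) = (\<lambda>n. 0)"
      by (rule ext, rule G0) simp
    ultimately show ?thesis by (simp add: LIMSEQ_const_iff)
  qed
  then show "cdf M = cdf N" by blast
qed

section \<open>Orthonormal polynomials\<close>

abbreviation cpoly :: "real poly \<Rightarrow> complex poly" where
  "cpoly \<equiv> map_poly of_real"

lemma coeff_cpoly [simp]: "coeff (cpoly q) k = of_real (coeff q k)"
  by (simp add: coeff_map_poly)

lemma degree_cpoly [simp]: "degree (cpoly q) = degree q"
  by (rule degree_map_poly) simp

lemma poly_cpoly_of_real [simp]: "poly (cpoly q) (of_real x) = of_real (poly q x)"
  by (simp add: poly_altdef)

text \<open>Induction on \<open>n\<close>: a multiple of \<open>P n\<close> removes the coefficient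
  of index n. The bound on \<open>q\<close> is put on coefficients rather than as
  \<open>degree q < n\<close>, so that n = 0 means q = 0.\<close>

lemma poly_in_span_lower_degree:
  fixes P :: "nat \<Rightarrow> 'a::field poly"
  assumes P: "\<And>k. degree (P k) = k" "\<And>k. P k \<noteq> 0"
    and q: "\<And>k. n \<le> k \<Longrightarrow> coeff q k = 0"
  shows "\<exists>c. q = (\<Sum>k<n. smult (c k) (P k))"
  using q
proof (induction n arbitrary: q)
  case 0
  then have "q = 0" by (intro poly_eqI) simp
  then show ?case by simp
next
  case (Suc n)
  define r where "r = q - smult (coeff q n / coeff (P n) n) (P n)"
  have Pn: "coeff (P n) n \<noteq> 0" using P[of n] by (metis leading_coeff_neq_0)
  have "coeff r k = 0" if "n \<le> k" for k
  proof (cases "k = n")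
    case True
    then show ?thesis using Pn by (simp add: r_def)
  next
    case False
    then show ?thesis using that Suc.prems[of k] P(1)[of n] by (simp add: r_def coeff_eq_0)
  qed
  then obtain c where c: "r = (\<Sum>k<n. smult (c k) (P k))" using Suc.IH by blast
  have "q = (\<Sum>k<Suc n. smult ((c(n := coeff q n / coeff (P n) n)) k) (P k))"
    using c by (simp add: r_def algebra_simps)
  then show ?case by blast
qed

text \<open>The value involves \<open>s\<close> alone, so measures with equal moments give every
  complex polynomial the same integral.\<close>

lemma has_moments_integrable_poly:
  fixes q :: "complex poly"
  assumes "has_moments M s"
  shows "integrable M (\<lambda>x. poly q (of_real x))"
    and "(\<integral>x. poly q (of_real x) \<partial>M) = (\<Sum>i\<le>degree q. coeff q i * of_real (s i))"
proof -
  have i: "integrable M (\<lambda>x. complex_of_real (x ^ i))" for i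
    using assms unfolding has_moments_def by (intro integrable_of_real) auto
  have e: "(\<integral>x. x ^ i \<partial>M) = s i" for i
    using assms unfolding has_moments_def by simp
  have eq: "poly q (of_real x) = (\<Sum>i\<le>degree q. coeff q i * of_real (x ^ i))" for x :: real
    by (simp add: poly_altdef)
  show "integrable M (\<lambda>x. poly q (of_real x))" unfolding eq using i by auto
  show "(\<integral>x. poly q (of_real x) \<partial>M) = (\<Sum>i\<le>degree q. coeff q i * of_real (s i))"
    unfolding eq using i by (simp add: e del: of_real_power)
qed

lemma has_moments_integrable_real_poly:
  assumes "has_moments M s"
  shows "integrable M (poly q)"
    and "(\<integral>x. poly q x \<partial>M) = (\<Sum>i\<le>degree q. coeff q i * s i)"
proof -
  show "integrable M (poly q)"
    using integrable_Re[OF has_moments_integrable_poly(1)[OF assms, of "cpoly q"]] by simp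
  have "complex_of_real (\<integral>x. poly q x \<partial>M) = of_real (\<Sum>i\<le>degree q. coeff q i * s i)"
    using has_moments_integrable_poly(2)[OF assms, of "cpoly q"]
    by (simp add: degree_map_poly)
  then show "(\<integral>x. poly q x \<partial>M) = (\<Sum>i\<le>degree q. coeff q i * s i)"
    by (simp only: of_real_eq_iff)
qed

lemma has_moments_real_distribution:
  assumes "has_moments M s" "s 0 = 1"
  shows "real_distribution M"
proof -
  have i: "integrable M (\<lambda>x. 1 :: real)" and m: "(\<integral>x. 1 \<partial>M) = (1 :: real)"
    using assms unfolding has_moments_def by (auto dest: spec[of _ 0])
  then have "emeasure M (space M) < \<infinity>" "measure M (space M) = 1"
    by (auto simp: integrable_iff_bounded)
  then have "prob_space M"
    by (intro prob_spaceI) (simp add: emeasure_eq_ennreal_measure less_top)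
  moreover have "sets M = sets borel" using assms by (simp add: has_moments_def)
  ultimately show ?thesis
    by (simp add: real_distribution_def real_distribution_axioms_def)
qed

lemma orthonormal_polynomials_transfer:
  assumes "has_moments M s" "has_moments N s" "orthonormal_polynomials M p"
  shows "orthonormal_polynomials N p"
proof -
  have "(\<integral>x. poly (p m) x * poly (p n) x \<partial>M) = (\<integral>x. poly (p m) x * poly (p n) x \<partial>N)" for m n
    using has_moments_integrable_real_poly(2)[OF assms(1), of "p m * p n"]
      has_moments_integrable_real_poly(2)[OF assms(2), of "p m * p n"] by simp
  then have "(\<integral>x. poly (p m) x * poly (p n) x \<partial>N) = (if m = n then 1 else 0)" for m n
    using assms(3) by (simp add: orthonormal_polynomials_def)
  with assms(3) show ?thesis unfolding orthonormal_polynomials_def by blast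
qed

locale moment_problem =
  fixes M :: "real measure" and s :: "nat \<Rightarrow> real" and p :: "nat \<Rightarrow> real poly"
  assumes moments: "has_moments M s"
    and normalized: "s 0 = 1"
    and orthonormal: "orthonormal_polynomials M p"

sublocale moment_problem \<subseteq> real_distribution M
  using has_moments_real_distribution[OF moments normalized] .

context moment_problem
begin

lemma degree_p [simp]: "degree (p n) = n"
  using orthonormal by (simp add: orthonormal_polynomials_def)

lemma leading_coeff_pos: "0 < coeff (p n) n"
  using orthonormal unfolding orthonormal_polynomials_def by (metis degree_p)

lemma cpoly_nonzero: "cpoly (p n) \<noteq> 0"
  using leading_coeff_pos[of n] by (metis coeff_0 coeff_cpoly less_numeral_extra(3) of_real_eq_0_iff)

lemma integrable_poly [simp, intro]:
  fixes q :: "complex poly"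
  shows "integrable M (\<lambda>x. poly q (of_real x))"
  by (rule has_moments_integrable_poly(1)[OF moments])

lemma integrable_real_poly [simp, intro]: "integrable M (poly q)"
  by (rule has_moments_integrable_real_poly(1)[OF moments])

lemma integral_p_p:
  "(\<integral>x. poly (p m) x * poly (p n) x \<partial>M) = (if m = n then 1 else 0)"
  using orthonormal by (simp add: orthonormal_polynomials_def)

lemma integrable_p_p [simp, intro]: "integrable M (\<lambda>x. poly (p m) x * poly (p n) x)"
  by (rule Bochner_Integration.integrable_cong[THEN iffD1, OF refl _ integrable_real_poly[of "p m * p n"]]) simp

text \<open>Expand the nonnegative mean square distance between \<open>f\<close> and its Fourier
  sum. Complex functions are handled later through their real and imaginary parts.\<close>

lemma bessel_inequality:
  fixes f :: "real \<Rightarrow> real"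
  assumes f2: "integrable M (\<lambda>x. (f x)\<^sup>2)"
    and fp: "\<And>k. integrable M (\<lambda>x. poly (p k) x * f x)"
  shows "(\<Sum>k<N. (\<integral>x. poly (p k) x * f x \<partial>M)\<^sup>2) \<le> (\<integral>x. (f x)\<^sup>2 \<partial>M)"
proof -
  define c where "c = (\<lambda>k. \<integral>x. poly (p k) x * f x \<partial>M)"
  have eq: "(f x - (\<Sum>k<N. c k * poly (p k) x))\<^sup>2 =
     (f x)\<^sup>2 - 2 * (\<Sum>k<N. c k * (poly (p k) x * f x)) +
     (\<Sum>j<N. \<Sum>k<N. c j * c k * (poly (p j) x * poly (p k) x))" for x
    by (simp add: power2_eq_square algebra_simps sum_distrib_left sum_product)
  have "0 \<le> (\<integral>x. (f x - (\<Sum>k<N. c k * poly (p k) x))\<^sup>2 \<partial>M)"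
    by (rule Bochner_Integration.integral_nonneg) simp
  also have "\<dots> = (\<integral>x. (f x)\<^sup>2 \<partial>M) - 2 * (\<Sum>k<N. c k * c k) +
      (\<Sum>j<N. \<Sum>k<N. c j * c k * (if j = k then 1 else 0))"
    unfolding eq using f2 fp by (simp add: integral_p_p c_def)
  also have "\<dots> = (\<integral>x. (f x)\<^sup>2 \<partial>M) - (\<Sum>k<N. (c k)\<^sup>2)"
    by (simp add: power2_eq_square if_distrib cong: if_cong)
  finally show ?thesis by (simp add: c_def)
qed

text \<open>\<open>p n\<close> minus its leading term lies in the span of the earlier polynomials
  and is orthogonal to \<open>p n\<close>; hence b times the n-th Fourier coefficient of x^n is 1.
  Bessel's inequality bounds the square of that coefficient by the integral of x^(2n).\<close>

lemma moment_times_leading_coeff: "1 \<le> s (2 * n) * (coeff (p n) n)\<^sup>2"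
proof -
  define b where "b = coeff (p n) n"
  have b: "b > 0" using leading_coeff_pos by (simp add: b_def)
  define r where "r = p n - smult b (monom 1 n)"
  have "coeff r k = 0" if "n \<le> k" for k
    using that by (cases "k = n") (auto simp: r_def b_def coeff_eq_0)
  moreover have "p k \<noteq> 0" for k using leading_coeff_pos[of k] by auto
  ultimately obtain c where c: "r = (\<Sum>k<n. smult (c k) (p k))"
    using poly_in_span_lower_degree[of p n r] by auto
  have "poly (p n) x * poly r x = (\<Sum>k<n. c k * (poly (p n) x * poly (p k) x))" for x
    by (simp add: c poly_sum sum_distrib_left mult_ac)
  then have "(\<integral>x. poly (p n) x * poly r x \<partial>M) = 0"
    by (simp add: integral_p_p)
  moreover have "poly (p n) x * poly r x = poly (p n) x * poly (p n) x - b * (poly (p n) x * x ^ n)" for x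
    by (simp add: r_def poly_monom algebra_simps)
  moreover have xn: "integrable M (\<lambda>x. poly (p k) x * x ^ n)" for k
    by (rule Bochner_Integration.integrable_cong[THEN iffD1, OF refl _ integrable_real_poly[of "p k * monom 1 n"]])
      (simp add: poly_monom)
  ultimately have e: "b * (\<integral>x. poly (p n) x * x ^ n \<partial>M) = 1"
    by (simp add: integral_p_p)
  have m: "integrable M (\<lambda>x. (x ^ n)\<^sup>2)" "(\<integral>x. (x ^ n)\<^sup>2 \<partial>M) = s (2 * n)"
    using moments by (auto simp: has_moments_def power_mult[symmetric] mult.commute)
  have "(\<integral>x. poly (p n) x * x ^ n \<partial>M)\<^sup>2 \<le> (\<Sum>k<Suc n. (\<integral>x. poly (p k) x * x ^ n \<partial>M)\<^sup>2)"
    by (simp add: sum_nonneg)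
  also have "\<dots> \<le> s (2 * n)" using bessel_inequality[OF m(1) xn, of "Suc n"] by (simp only: m(2))
  finally have "(b * (\<integral>x. poly (p n) x * x ^ n \<partial>M))\<^sup>2 \<le> s (2 * n) * b\<^sup>2"
    by (subst power_mult_distrib, subst mult.commute) (rule mult_right_mono, auto)
  then show ?thesis unfolding e by (simp add: b_def)
qed

lemma integral_cpoly_p:
  "(\<integral>x. poly (cpoly (p j)) (of_real x) * poly (cpoly (p k)) (of_real x) \<partial>M) = (if j = k then 1 else 0)"
proof -
  have "(\<integral>x. poly (cpoly (p j)) (of_real x) * poly (cpoly (p k)) (of_real x) \<partial>M) =
      (\<integral>x. complex_of_real (poly (p j) x * poly (p k) x) \<partial>M)" by simp
  also have "\<dots> = of_real (if j = k then 1 else 0)"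
    by (subst integral_of_real) (auto simp: integral_p_p)
  finally show ?thesis by auto
qed

lemma integrable_cpoly_p [simp, intro]:
  fixes q :: "complex poly"
  shows "integrable M (\<lambda>x. poly q (of_real x) * poly q' (of_real x))"
  by (rule Bochner_Integration.integrable_cong[THEN iffD1, OF refl _ integrable_poly[of "q * q'"]]) simp

text \<open>Pairing a representation in the span with \<open>p m\<close> isolates its m-th
  coefficient. The pairing is bilinear, without conjugation: the \<open>p m\<close> are real on the
  line.\<close>

lemma poly_expansion:
  fixes q :: "complex poly"
  assumes "\<And>k. n \<le> k \<Longrightarrow> coeff q k = 0"
  shows "q = (\<Sum>k<n. smult (\<integral>x. poly q (of_real x) * poly (cpoly (p k)) (of_real x) \<partial>M) (cpoly (p k)))"
    and "n \<le> m \<Longrightarrow> (\<integral>x. poly q (of_real x) * poly (cpoly (p m)) (of_real x) \<partial>M) = 0"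
proof -
  obtain c where c: "q = (\<Sum>k<n. smult (c k) (cpoly (p k)))"
    using poly_in_span_lower_degree[of "\<lambda>k. cpoly (p k)" n q] cpoly_nonzero assms by auto
  have "poly q (of_real x) * poly (cpoly (p m)) (of_real x) =
      (\<Sum>k<n. c k * (poly (cpoly (p k)) (of_real x) * poly (cpoly (p m)) (of_real x)))" for x :: real and m
    by (simp add: c poly_sum sum_distrib_right mult.assoc del: poly_cpoly_of_real)
  then have "(\<integral>x. poly q (of_real x) * poly (cpoly (p m)) (of_real x) \<partial>M) =
     (\<Sum>k<n. if k = m then c k else 0)" for m
    by (simp add: integral_cpoly_p if_distrib del: poly_cpoly_of_real cong: if_cong)
  then have co: "(\<integral>x. poly q (of_real x) * poly (cpoly (p m)) (of_real x) \<partial>M) =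
     (if m < n then c m else 0)" for m
    by simp
  show "n \<le> m \<Longrightarrow> (\<integral>x. poly q (of_real x) * poly (cpoly (p m)) (of_real x) \<partial>M) = 0"
    by (simp add: co del: poly_cpoly_of_real)
  show "q = (\<Sum>k<n. smult (\<integral>x. poly q (of_real x) * poly (cpoly (p k)) (of_real x) \<partial>M) (cpoly (p k)))"
    unfolding co by (subst c) (intro sum.cong, auto)
qed

end

section \<open>Square summability and local boundedness\<close>

text \<open>\<open>synthetic_div q z\<close> is the quotient (q(x) - q(z))/(x - z), a polynomial in
  x.\<close>

lemma resolvent_times_linear:
  assumes "Im z \<noteq> 0"
  shows "poly q (of_real x) * (1 / (of_real x - z)) =
    poly (synthetic_div q z) (of_real x) + poly q z * (1 / (of_real x - z))"
proof -
  have "of_real x - z \<noteq> 0" using assms by (auto simp: complex_eq_iff)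
  moreover have "poly q (of_real x) = poly ([:-z, 1:] * synthetic_div q z + [:poly q z:]) (of_real x)"
    by (simp only: synthetic_div_correct')
  ultimately show ?thesis by (simp add: field_simps)
qed

text \<open>Discrete Gronwall inequality: the sums satisfy S(n+1) <= (1 + \<open>\<alpha> n\<close>)
  S(n) + \<open>\<beta> n\<close>, and 1 + x <= exp x turns the product of the factors into an
  exponential of a sum.\<close>

lemma sum_le_exp_if_volterra:
  fixes y \<alpha> \<beta> :: "nat \<Rightarrow> real"
  assumes y: "\<And>n. y n \<le> \<beta> n + \<alpha> n * (\<Sum>k<n. y k)"
    and "\<And>n. 0 \<le> \<alpha> n" "\<And>n. 0 \<le> \<beta> n"
  shows "(\<Sum>k<n. y k) \<le> (\<Sum>k<n. \<beta> k) * exp (\<Sum>k<n. \<alpha> k)"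
proof (induction n)
  case (Suc n)
  let ?B = "\<Sum>k<n. \<beta> k" and ?A = "\<Sum>k<n. \<alpha> k"
  have "(\<Sum>k<Suc n. y k) \<le> (1 + \<alpha> n) * (\<Sum>k<n. y k) + \<beta> n"
    using y[of n] by (simp add: algebra_simps)
  also have "\<dots> \<le> exp (\<alpha> n) * (?B * exp ?A) + exp (\<alpha> n) * (\<beta> n * exp ?A)"
  proof (rule add_mono)
    have "(1 + \<alpha> n) * (\<Sum>k<n. y k) \<le> (1 + \<alpha> n) * (?B * exp ?A)"
      using Suc.IH assms(2)[of n] by (intro mult_left_mono) auto
    also have "\<dots> \<le> exp (\<alpha> n) * (?B * exp ?A)"
      using assms(3) exp_ge_add_one_self[of "\<alpha> n"] by (intro mult_right_mono) (auto intro!: sum_nonneg mult_nonneg_nonneg)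
    finally show "(1 + \<alpha> n) * (\<Sum>k<n. y k) \<le> exp (\<alpha> n) * (?B * exp ?A)" .
    have "1 \<le> exp (\<alpha> n + ?A)" using assms(2) by (simp add: sum_nonneg)
    then have "\<beta> n * 1 \<le> \<beta> n * exp (\<alpha> n + ?A)" using assms(3)[of n] by (intro mult_left_mono) auto
    then show "\<beta> n \<le> exp (\<alpha> n) * (\<beta> n * exp ?A)" by (simp add: exp_add mult_ac)
  qed
  also have "\<dots> = (\<Sum>k<Suc n. \<beta> k) * exp (\<Sum>k<Suc n. \<alpha> k)"
    by (simp add: exp_add algebra_simps)
  finally show ?case .
qed auto

lemma norm_add_power2_le:
  fixes a b :: "'a::real_normed_vector"
  shows "(norm (a + b))\<^sup>2 \<le> 2 * (norm a)\<^sup>2 + 2 * (norm b)\<^sup>2"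
proof -
  have "(norm (a + b))\<^sup>2 \<le> (norm a + norm b)\<^sup>2"
    by (intro power_mono norm_triangle_ineq) auto
  also have "\<dots> \<le> 2 * (norm a)\<^sup>2 + 2 * (norm b)\<^sup>2"
    using sum_squares_bound[of "norm a" "norm b"] by (simp add: power2_sum)
  finally show ?thesis .
qed

lemma norm_sum_mult_power2_le:
  fixes a b :: "nat \<Rightarrow> 'a::real_normed_field"
  shows "(norm (\<Sum>k\<in>A. a k * b k))\<^sup>2 \<le> (\<Sum>k\<in>A. (norm (a k))\<^sup>2) * (\<Sum>k\<in>A. (norm (b k))\<^sup>2)"
proof -
  have "norm (\<Sum>k\<in>A. a k * b k) \<le> (\<Sum>k\<in>A. \<bar>norm (a k)\<bar> * \<bar>norm (b k)\<bar>)"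
    by (rule order_trans[OF norm_sum]) (simp add: norm_mult)
  also have "\<dots> \<le> L2_set (\<lambda>k. norm (a k)) A * L2_set (\<lambda>k. norm (b k)) A"
    by (rule L2_set_mult_ineq)
  finally have "(norm (\<Sum>k\<in>A. a k * b k))\<^sup>2 \<le> (L2_set (\<lambda>k. norm (a k)) A * L2_set (\<lambda>k. norm (b k)) A)\<^sup>2"
    by (intro power_mono) auto
  then show ?thesis by (simp add: L2_set_def power_mult_distrib sum_nonneg)
qed

section \<open>Fourier coefficients of the resolvent and the Volterra equation\<close>

context moment_problem
begin

text \<open>The n-th Fourier coefficient of x |-> 1/(x - z) with respect to
  \<open>M\<close>.\<close>

definition resolvent_coeff :: "complex \<Rightarrow> nat \<Rightarrow> complex" where
  "resolvent_coeff z n = (\<integral>x. poly (cpoly (p n)) (of_real x) * (1 / (of_real x - z)) \<partial>M)"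

lemma integrable_poly_resolvent:
  assumes "Im z \<noteq> 0"
  shows "integrable M (\<lambda>x. poly q (of_real x) * (1 / (of_real x - z)))"
proof (rule Bochner_Integration.integrable_bound)
  show "integrable M (\<lambda>x. (1 / \<bar>Im z\<bar>) *\<^sub>R poly q (of_real x))" by auto
  have "(\<lambda>x. 1 / (complex_of_real x - z)) \<in> borel_measurable M"
    using borel_measurable_resolvent[OF assms] by (simp cong: measurable_cong_sets)
  moreover have "(\<lambda>x. poly q (complex_of_real x)) \<in> borel_measurable M"
    using integrable_poly by (rule borel_measurable_integrable)
  ultimately show "(\<lambda>x. poly q (of_real x) * (1 / (of_real x - z))) \<in> borel_measurable M"
    by (rule borel_measurable_times[rotated])
  show "AE x in M. norm (poly q (of_real x) * (1 / (of_real x - z))) \<le> norm ((1 / \<bar>Im z\<bar>) *\<^sub>R poly q (of_real x))"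
  proof (rule AE_I2)
    fix x :: real
    have "cmod (poly q (of_real x)) * cmod (1 / (of_real x - z)) \<le> cmod (poly q (of_real x)) * (1 / \<bar>Im z\<bar>)"
      by (intro mult_left_mono norm_resolvent_le[OF assms]) auto
    then show "norm (poly q (of_real x) * (1 / (of_real x - z))) \<le> norm ((1 / \<bar>Im z\<bar>) *\<^sub>R poly q (of_real x))"
      by (simp only: norm_mult norm_scaleR) (simp add: mult.commute)
  qed
qed

text \<open>The resolvent is bounded by 1/|Im z|, so its real and imaginary parts are square
  integrable and Bessel's inequality applies to each.\<close>

lemma summable_resolvent_coeff:
  assumes z: "Im z \<noteq> 0"
  shows "summable (\<lambda>n. (cmod (resolvent_coeff z n))\<^sup>2)"
proof -
  define f where "f = (\<lambda>x. 1 / (complex_of_real x - z))"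
  have fm: "f \<in> borel_measurable M"
    using borel_measurable_resolvent[OF z] by (simp add: f_def cong: measurable_cong_sets)
  define C where "C = 1 / \<bar>Im z\<bar>"
  have fb: "cmod (f x) \<le> C" for x
    using norm_resolvent_le[OF z] by (simp add: f_def C_def)
  have i: "integrable M (\<lambda>x. poly (cpoly (p n)) (of_real x) * f x)" for n
    using integrable_poly_resolvent[OF z] by (simp only: f_def)
  have u: "resolvent_coeff z n = (\<integral>x. poly (cpoly (p n)) (of_real x) * f x \<partial>M)" for n
    by (simp only: resolvent_coeff_def f_def)
  have Re: "Re (resolvent_coeff z n) = (\<integral>x. poly (p n) x * Re (f x) \<partial>M)"
    and Im: "Im (resolvent_coeff z n) = (\<integral>x. poly (p n) x * Im (f x) \<partial>M)" for n
    unfolding u using integral_Re[OF i[of n]] integral_Im[OF i[of n]] by simp_all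
  have iR: "integrable M (\<lambda>x. poly (p n) x * Re (f x))"
    and iI: "integrable M (\<lambda>x. poly (p n) x * Im (f x))" for n
    using integrable_Re[OF i[of n]] integrable_Im[OF i[of n]] by simp_all
  have sq: "(Re (f x))\<^sup>2 \<le> C\<^sup>2" "(Im (f x))\<^sup>2 \<le> C\<^sup>2" for x
    using power_mono[of "\<bar>Re (f x)\<bar>" C 2] power_mono[of "\<bar>Im (f x)\<bar>" C 2]
      abs_Re_le_cmod[of "f x"] abs_Im_le_cmod[of "f x"] fb[of x] by simp_all
  have f2: "integrable M (\<lambda>x. (Re (f x))\<^sup>2)" "integrable M (\<lambda>x. (Im (f x))\<^sup>2)"
    using sq fm by (auto intro!: integrable_const_bound[where B = "C\<^sup>2"])
  show ?thesis
  proof (rule summableI_nonneg_bounded)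
    fix N
    have "(\<Sum>n<N. (cmod (resolvent_coeff z n))\<^sup>2) =
        (\<Sum>n<N. (\<integral>x. poly (p n) x * Re (f x) \<partial>M)\<^sup>2) + (\<Sum>n<N. (\<integral>x. poly (p n) x * Im (f x) \<partial>M)\<^sup>2)"
      by (simp add: cmod_power2 Re Im sum.distrib)
    also have "\<dots> \<le> (\<integral>x. (Re (f x))\<^sup>2 \<partial>M) + (\<integral>x. (Im (f x))\<^sup>2 \<partial>M)"
      by (intro add_mono bessel_inequality f2 iR iI)
    finally show "(\<Sum>n<N. (cmod (resolvent_coeff z n))\<^sup>2) \<le> (\<integral>x. (Re (f x))\<^sup>2 \<partial>M) + (\<integral>x. (Im (f x))\<^sup>2 \<partial>M)" .
  qed auto
qed

text \<open>The first summand is the polynomial of the second kind at z, which depends only on the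
  moments; the measure itself enters only through its Stieltjes transform.\<close>

lemma resolvent_coeff_eq:
  assumes "Im z \<noteq> 0"
  shows "resolvent_coeff z n =
    (\<integral>x. poly (synthetic_div (cpoly (p n)) z) (of_real x) \<partial>M) + poly (cpoly (p n)) z * stieltjes M z"
  unfolding resolvent_coeff_def resolvent_times_linear[OF assms] stieltjes_def
    Bochner_Integration.integral_add[OF integrable_poly integrable_mult_right[OF integrable_resolvent[OF assms]]]
    integral_mult_right_zero ..

text \<open>The quotient \<open>(P\<^sub>n(x) - P\<^sub>n(z\<^sub>0)) / (x - z\<^sub>0)\<close> expanded in the orthonormal polynomials:
  its coefficients are square summable in both indices as soon as \<open>(P\<^sub>n(z\<^sub>0))\<close> is.\<close>

lemma p_minus_p_expansion:
  assumes z0: "Im z0 \<noteq> 0"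
  shows "poly (cpoly (p n)) z = poly (cpoly (p n)) z0 + (z - z0) *
    (\<Sum>k<n. (poly (cpoly (p k)) z0 * resolvent_coeff z0 n - poly (cpoly (p n)) z0 * resolvent_coeff z0 k) *
      poly (cpoly (p k)) z)"
proof -
  define P where "P = (\<lambda>n. cpoly (p n))"
  define q where "q = (\<lambda>n. synthetic_div (P n) z0)"
  define R where "R = (\<lambda>x. 1 / (complex_of_real x - z0))"
  have qc: "coeff (q n) k = 0" if "n \<le> k" for n k
  \<comment> \<open>The quotient has degree n - 1, which truncated subtraction makes 0 for n = 0;
    there it must be seen to vanish.\<close>
  proof (cases "n = 0")
    case True
    then show ?thesis using synthetic_div_eq_0_iff[of "P n" z0] by (simp add: q_def P_def)
  next
    case False
    then have "degree (q n) < k" using that by (simp add: q_def P_def degree_synthetic_div)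
    then show ?thesis by (rule coeff_eq_0)
  qed
  have res: "poly (P n) (of_real x) * R x = poly (q n) (of_real x) + poly (P n) z0 * R x" for n x
    using resolvent_times_linear[OF z0] by (simp add: R_def q_def)
  have iR: "integrable M (\<lambda>x. poly r (of_real x) * R x)" for r
    using integrable_poly_resolvent[OF z0] by (simp only: R_def)
  have u: "resolvent_coeff z0 n = (\<integral>x. poly (P n) (of_real x) * R x \<partial>M)" for n
    by (simp add: resolvent_coeff_def P_def R_def del: poly_cpoly_of_real)
  have coeff: "(\<integral>x. poly (q n) (of_real x) * poly (P k) (of_real x) \<partial>M) =
      poly (P k) z0 * resolvent_coeff z0 n - poly (P n) z0 * resolvent_coeff z0 k" if "k < n" for k
  proof -
    \<comment> \<open>The degree of \<open>q k\<close> is too small to pair with \<open>P n\<close>.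
      Subtracting this zero integral makes the products P_n P_k R cancel, leaving only the Fourier
      coefficients of the resolvent.\<close>
    have "(\<integral>x. poly (q k) (of_real x) * poly (P n) (of_real x) \<partial>M) = 0"
      unfolding P_def using that by (intro poly_expansion(2)[of k]) (auto intro: qc)
    moreover have "poly (q n) (of_real x) * poly (P k) (of_real x) =
        poly (q k) (of_real x) * poly (P n) (of_real x) + poly (P k) z0 * (poly (P n) (of_real x) * R x)
          - poly (P n) z0 * (poly (P k) (of_real x) * R x)" for x
      using res[of n x] res[of k x] by algebra
    ultimately show ?thesis
      using iR[of "P n"] iR[of "P k"] integrable_cpoly_p[of "q k" "P n"] by (simp add: u)
  qed
  have "q n = (\<Sum>k<n. smult (\<integral>x. poly (q n) (of_real x) * poly (P k) (of_real x) \<partial>M) (P k))"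
    unfolding P_def by (rule poly_expansion(1)) (rule qc)
  also have "\<dots> = (\<Sum>k<n. smult (poly (P k) z0 * resolvent_coeff z0 n - poly (P n) z0 * resolvent_coeff z0 k) (P k))"
    by (intro sum.cong) (auto simp: coeff)
  finally have qn: "poly (q n) z = (\<Sum>k<n. (poly (P k) z0 * resolvent_coeff z0 n - poly (P n) z0 * resolvent_coeff z0 k) * poly (P k) z)"
    by (simp add: poly_sum)
  have "poly (P n) z = poly ([:-z0, 1:] * q n + [:poly (P n) z0:]) z"
    unfolding q_def by (simp only: synthetic_div_correct')
  also have "\<dots> = poly (P n) z0 + (z - z0) * poly (q n) z" by (simp add: algebra_simps)
  finally show ?thesis unfolding qn by (simp add: P_def)
qed

text \<open>By Cauchy-Schwarz the Volterra equation bounds |P_n(z)|^2 by 2 \<open>b n\<close> plus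
  \<open>\<alpha> n\<close> times the sum of the earlier squares. Since \<open>b\<close> and
  \<open>v\<close> are summable, so is \<open>\<alpha>\<close>, and Gronwall's bound depends only on
  r.\<close>

lemma partial_sums_locally_bounded:
  assumes z0: "Im z0 \<noteq> 0" and sum0: "summable (\<lambda>n. (cmod (poly (cpoly (p n)) z0))\<^sup>2)"
  obtains B where "\<And>z N. cmod z \<le> r \<Longrightarrow> (\<Sum>n<N. (cmod (poly (cpoly (p n)) z))\<^sup>2) \<le> B"
proof -
  define b where "b = (\<lambda>n. (cmod (poly (cpoly (p n)) z0))\<^sup>2)"
  define v where "v = (\<lambda>n. (cmod (resolvent_coeff z0 n))\<^sup>2)"
  define T U where "T = suminf b" and "U = suminf v"
  have b: "summable b" "\<And>n. b n \<ge> 0" using sum0 by (auto simp: b_def)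
  have v: "summable v" "\<And>n. v n \<ge> 0" using summable_resolvent_coeff[OF z0] by (auto simp: v_def)
  have bs: "(\<Sum>k<n. b k) \<le> T" and vs: "(\<Sum>k<n. v k) \<le> U" for n
    unfolding T_def U_def using b v by (auto intro: sum_le_suminf)
  have nn: "T \<ge> 0" "U \<ge> 0" unfolding T_def U_def using b v by (auto intro: suminf_nonneg)
  \<comment> \<open>\<open>R\<close> dominates |z - z0| on the disc. In \<open>\<alpha>\<close>, the
    outer 2 comes from splitting off P_n(z0), the inner ones from splitting the kernel into its two
    products.\<close>
  define R where "R = \<bar>r\<bar> + cmod z0"
  define \<alpha> where "\<alpha> = (\<lambda>n. 2 * R\<^sup>2 * (2 * v n * T + 2 * b n * U))"
  have \<alpha>0: "\<alpha> n \<ge> 0" for n unfolding \<alpha>_def using nn b(2)[of n] v(2)[of n] by simp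
  show thesis
  proof (rule that)
    fix z N assume z: "cmod z \<le> r"
    define y where "y = (\<lambda>n. (cmod (poly (cpoly (p n)) z))\<^sup>2)"
    have R: "(cmod (z - z0))\<^sup>2 \<le> R\<^sup>2"
      using norm_triangle_ineq4[of z z0] z by (intro power_mono) (auto simp: R_def)
    have "y n \<le> 2 * b n + \<alpha> n * (\<Sum>k<n. y k)" for n
    proof -
      define a where "a = (\<lambda>k. poly (cpoly (p k)) z0 * resolvent_coeff z0 n - poly (cpoly (p n)) z0 * resolvent_coeff z0 k)"
      have "(\<Sum>k<n. (cmod (a k))\<^sup>2) \<le> (\<Sum>k<n. 2 * v n * b k + 2 * b n * v k)"
      proof (rule sum_mono)
        fix k
        show "(cmod (a k))\<^sup>2 \<le> 2 * v n * b k + 2 * b n * v k"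
          using norm_add_power2_le[of "poly (cpoly (p k)) z0 * resolvent_coeff z0 n" "- (poly (cpoly (p n)) z0 * resolvent_coeff z0 k)"]
          by (simp add: a_def b_def v_def norm_mult power_mult_distrib mult_ac)
      qed
      also have "\<dots> = 2 * v n * (\<Sum>k<n. b k) + 2 * b n * (\<Sum>k<n. v k)"
        by (simp add: sum.distrib sum_distrib_left)
      also have "\<dots> \<le> 2 * v n * T + 2 * b n * U"
        using b v bs vs by (intro add_mono mult_left_mono) auto
      finally have a: "(\<Sum>k<n. (cmod (a k))\<^sup>2) \<le> 2 * v n * T + 2 * b n * U" .
      have "y n \<le> 2 * b n + 2 * (cmod ((z - z0) * (\<Sum>k<n. a k * poly (cpoly (p k)) z)))\<^sup>2"
        unfolding y_def b_def
        by (subst p_minus_p_expansion[OF z0, of n z]) (rule norm_add_power2_le[THEN order_trans], simp add: a_def)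
      also have "(cmod ((z - z0) * (\<Sum>k<n. a k * poly (cpoly (p k)) z)))\<^sup>2
          = (cmod (z - z0))\<^sup>2 * (cmod (\<Sum>k<n. a k * poly (cpoly (p k)) z))\<^sup>2"
        by (simp add: norm_mult power_mult_distrib)
      also have "\<dots> \<le> R\<^sup>2 * ((2 * v n * T + 2 * b n * U) * (\<Sum>k<n. y k))"
      proof (intro mult_mono R)
        have "(cmod (\<Sum>k<n. a k * poly (cpoly (p k)) z))\<^sup>2 \<le> (\<Sum>k<n. (cmod (a k))\<^sup>2) * (\<Sum>k<n. y k)"
          unfolding y_def by (rule norm_sum_mult_power2_le)
        also have "\<dots> \<le> (2 * v n * T + 2 * b n * U) * (\<Sum>k<n. y k)"
          by (intro mult_right_mono a sum_nonneg) (auto simp: y_def)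
        finally show "(cmod (\<Sum>k<n. a k * poly (cpoly (p k)) z))\<^sup>2 \<le> (2 * v n * T + 2 * b n * U) * (\<Sum>k<n. y k)" .
      qed auto
      finally show ?thesis by (simp add: \<alpha>_def mult_ac)
    qed
    then have "(\<Sum>n<N. y n) \<le> (\<Sum>n<N. 2 * b n) * exp (\<Sum>n<N. \<alpha> n)"
      using b \<alpha>0 by (intro sum_le_exp_if_volterra) auto
    also have "\<dots> \<le> (2 * T) * exp (2 * R\<^sup>2 * (2 * U * T + 2 * T * U))"
    proof (rule mult_mono)
      show "(\<Sum>n<N. 2 * b n) \<le> 2 * T" using bs[of N] by (simp flip: sum_distrib_left)
      have "(\<Sum>n<N. \<alpha> n) = 2 * R\<^sup>2 * (2 * (\<Sum>n<N. v n) * T + 2 * (\<Sum>n<N. b n) * U)"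
        by (simp add: \<alpha>_def sum.distrib sum_distrib_left sum_distrib_right distrib_left)
      also have "\<dots> \<le> 2 * R\<^sup>2 * (2 * U * T + 2 * T * U)"
        using bs[of N] vs[of N] nn by (intro mult_left_mono add_mono mult_right_mono) auto
      finally show "exp (\<Sum>n<N. \<alpha> n) \<le> exp (2 * R\<^sup>2 * (2 * U * T + 2 * T * U))" by simp
    qed (use nn in auto)
    finally show "(\<Sum>n<N. (cmod (poly (cpoly (p n)) z))\<^sup>2) \<le> (2 * T) * exp (2 * R\<^sup>2 * (2 * U * T + 2 * T * U))"
      by (simp add: y_def)
  qed
qed

end

text \<open>The polynomials of the second kind agree for both measures and cancel in the difference
  of the Fourier coefficients. What is left is P_n(z) times the nonzero number d.\<close>

lemma summable_if_stieltjes_neq: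
  assumes M: "moment_problem M s p" and N: "moment_problem N s p"
    and z: "Im z \<noteq> 0" and ne: "stieltjes M z \<noteq> stieltjes N z"
  shows "summable (\<lambda>n. (cmod (poly (cpoly (p n)) z))\<^sup>2)"
proof -
  define d where "d = stieltjes M z - stieltjes N z"
  define u v where "u = moment_problem.resolvent_coeff M p z" and "v = moment_problem.resolvent_coeff N p z"
  have "u n - v n = poly (cpoly (p n)) z * d" for n
    unfolding u_def v_def moment_problem.resolvent_coeff_eq[OF M z] moment_problem.resolvent_coeff_eq[OF N z] d_def
    by (simp add: has_moments_integrable_poly(2)[OF moment_problem.moments[OF M]]
        has_moments_integrable_poly(2)[OF moment_problem.moments[OF N]] algebra_simps)
  moreover have "d \<noteq> 0" using ne by (simp add: d_def)
  ultimately have eq: "poly (cpoly (p n)) z = (u n - v n) / d" for n by (simp add: field_simps)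
  have "summable (\<lambda>n. (2 * (cmod (u n))\<^sup>2 + 2 * (cmod (v n))\<^sup>2) / (cmod d)\<^sup>2)"
    unfolding u_def v_def using moment_problem.summable_resolvent_coeff[OF M z] moment_problem.summable_resolvent_coeff[OF N z]
    by (intro summable_divide summable_add summable_mult)
  then show ?thesis
  proof (rule summable_comparison_test'[where N = 0])
    fix n
    have "(cmod (u n - v n))\<^sup>2 \<le> 2 * (cmod (u n))\<^sup>2 + 2 * (cmod (v n))\<^sup>2"
      using norm_add_power2_le[of "u n" "- v n"] by simp
    then show "norm ((cmod (poly (cpoly (p n)) z))\<^sup>2) \<le> (2 * (cmod (u n))\<^sup>2 + 2 * (cmod (v n))\<^sup>2) / (cmod d)\<^sup>2"
      by (simp add: eq norm_divide power_divide divide_right_mono)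
  qed
qed

section \<open>Convergence on the whole plane in the indeterminate case\<close>

locale indeterminate_moment_problem = moment_problem +
  assumes indeterminate: "indeterminate s"
begin

text \<open>The two measures witnessing indeterminacy may both differ from \<open>M\<close>, so
  orthonormality of \<open>p\<close> is first carried over to each of them.\<close>

lemma ex_nonreal_summable:
  obtains z0 where "Im z0 \<noteq> 0" "summable (\<lambda>n. (cmod (poly (cpoly (p n)) z0))\<^sup>2)"
proof -
  obtain N1 N2 where N: "has_moments N1 s" "has_moments N2 s" "N1 \<noteq> N2"
    using indeterminate by (auto simp: indeterminate_def)
  have mp: "moment_problem N1 s p" "moment_problem N2 s p"
    using N normalized orthonormal_polynomials_transfer[OF moments _ orthonormal]
    by (auto simp: moment_problem_def)
  obtain z0 where "Im z0 > 0" "stieltjes N1 z0 \<noteq> stieltjes N2 z0"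
    using stieltjes_unique[of N1 N2] N(3) has_moments_real_distribution[OF N(1) normalized]
      has_moments_real_distribution[OF N(2) normalized] by blast
  then show thesis using that[of z0] summable_if_stieltjes_neq[OF mp] by simp
qed

lemma partial_sums_bounded:
  obtains B where "\<And>z N. cmod z \<le> r \<Longrightarrow> (\<Sum>n<N. (cmod (poly (cpoly (p n)) z))\<^sup>2) \<le> B"
  using ex_nonreal_summable partial_sums_locally_bounded by metis

lemma summable_p: "summable (\<lambda>n. (cmod (poly (cpoly (p n)) z))\<^sup>2)"
proof -
  obtain B where "\<And>w N. cmod w \<le> cmod z \<Longrightarrow> (\<Sum>n<N. (cmod (poly (cpoly (p n)) w))\<^sup>2) \<le> B"
    using partial_sums_bounded[of "cmod z"] by blast
  then show ?thesis by (intro summableI_nonneg_bounded[where x = B]) auto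
qed

end

section \<open>Comparison of the coefficients with the maximum modulus\<close>

context indeterminate_moment_problem
begin

lemma coeff_p_zero [simp]: "n < k \<Longrightarrow> coeff (p n) k = 0"
  by (rule coeff_eq_0) simp

lemma norm_Pfun: "cmod (Pfun p z) = sqrt (\<Sum>n. (cmod (poly (cpoly (p n)) z))\<^sup>2)"
  unfolding Pfun_def by (simp add: suminf_nonneg summable_p)

lemma partial_sum_le_Pfun: "(\<Sum>n<N. (cmod (poly (cpoly (p n)) z))\<^sup>2) \<le> (cmod (Pfun p z))\<^sup>2"
  unfolding norm_Pfun by (simp add: suminf_nonneg summable_p sum_le_suminf)

text \<open>\<open>max_modulus\<close> is a real supremum, which dominates the values only once they
  are known to be bounded.\<close>

lemma bdd_above_Pfun: "bdd_above ((\<lambda>z. cmod (Pfun p z)) ` cball 0 r)"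
proof -
  obtain B where B: "\<And>z N. cmod z \<le> r \<Longrightarrow> (\<Sum>n<N. (cmod (poly (cpoly (p n)) z))\<^sup>2) \<le> B"
    using partial_sums_bounded[of r] by blast
  have "cmod (Pfun p z) \<le> sqrt B" if "cmod z \<le> r" for z
    unfolding norm_Pfun using B[OF that] by (intro real_sqrt_le_mono suminf_le_const summable_p)
  then show ?thesis by (intro bdd_aboveI2) auto
qed

lemma Pfun_le_max_modulus: "cmod z \<le> r \<Longrightarrow> cmod (Pfun p z) \<le> max_modulus (Pfun p) r"
  unfolding max_modulus_def by (rule cSUP_upper[OF _ bdd_above_Pfun]) simp

lemma max_modulus_Pfun_pos:
  assumes "0 \<le> r"
  shows "0 < max_modulus (Pfun p) r"
proof -
  have "0 < (cmod (poly (cpoly (p 0)) 0))\<^sup>2"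
    using leading_coeff_pos[of 0] by (simp add: poly_0_coeff_0)
  also have "\<dots> \<le> (cmod (Pfun p 0))\<^sup>2" using partial_sum_le_Pfun[where N = 1 and z = 0] by simp
  finally have "0 < cmod (Pfun p 0)" by (simp add: zero_less_power2)
  also have "\<dots> \<le> max_modulus (Pfun p) r" using assms by (intro Pfun_le_max_modulus) simp
  finally show ?thesis .
qed

end

lemma norm_coeff_le_max_norm_poly:
  fixes q :: "complex poly"
  assumes "0 < r" and "\<And>z. cmod z = r \<Longrightarrow> cmod (poly q z) \<le> B"
  shows "cmod (coeff q k) * r ^ k \<le> B"
proof -
  have hd: "(deriv ^^ k) (poly q) = poly ((pderiv ^^ k) q)"
  proof (induction k)
    case (Suc k)
    then show ?case by (auto intro!: ext DERIV_imp_deriv poly_DERIV)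
  qed simp
  have "cmod ((deriv ^^ k) (poly q) 0) \<le> fact k * B / r ^ k"
    using assms by (intro Cauchy_inequality) (auto intro!: holomorphic_intros continuous_intros)
  also have "(deriv ^^ k) (poly q) 0 = fact k * coeff q k"
    by (simp add: hd poly_0_coeff_0 coeff_higher_pderiv pochhammer_fact)
  finally have "fact k * cmod (coeff q k) \<le> fact k * (B / r ^ k)"
    by (simp add: norm_mult)
  then have "cmod (coeff q k) \<le> B / r ^ k"
    by (rule mult_left_le_imp_le) simp
  then show ?thesis using assms(1) by (simp add: field_simps)
qed

context indeterminate_moment_problem
begin

text \<open>The squared \<open>\<ell>\<^sup>2\<close>-norm of \<open>(b\<^sub>k\<^sub>,\<^sub>n)\<^sub>n\<close> is the \<open>k\<close>-th coefficient of the single polynomial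
  \<open>\<Sum>\<^sub>n b\<^sub>k\<^sub>,\<^sub>n P\<^sub>n\<close>, to which Cauchy's estimate applies.\<close>

lemma partial_cseq_le:
  assumes r: "0 < r"
  shows "sqrt (\<Sum>n<N. (coeff (p n) k)\<^sup>2) * r ^ k \<le> max_modulus (Pfun p) r"
proof -
  define A where "A = (\<Sum>n<N. (coeff (p n) k)\<^sup>2)"
  have A0: "A \<ge> 0" by (simp add: A_def sum_nonneg)
  define q where "q = (\<Sum>n<N. smult (of_real (coeff (p n) k)) (cpoly (p n)))"
  have "cmod (poly q z) \<le> sqrt A * max_modulus (Pfun p) r" if "cmod z = r" for z
  proof -
    have "(cmod (poly q z))\<^sup>2 \<le> A * (\<Sum>n<N. (cmod (poly (cpoly (p n)) z))\<^sup>2)"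
      using norm_sum_mult_power2_le[of "\<lambda>n. of_real (coeff (p n) k)" "\<lambda>n. poly (cpoly (p n)) z" "{..<N}"]
      by (simp add: q_def poly_sum A_def)
    also have "\<dots> \<le> A * (cmod (Pfun p z))\<^sup>2"
      using A0 by (intro mult_left_mono partial_sum_le_Pfun)
    also have "\<dots> = (sqrt A * cmod (Pfun p z))\<^sup>2" using A0 by (simp add: power_mult_distrib)
    finally have "cmod (poly q z) \<le> sqrt A * cmod (Pfun p z)"
      by (rule power2_le_imp_le) (use A0 in simp)
    also have "\<dots> \<le> sqrt A * max_modulus (Pfun p) r"
      using A0 that by (intro mult_left_mono Pfun_le_max_modulus) auto
    finally show ?thesis .
  qed
  then have "cmod (coeff q k) * r ^ k \<le> sqrt A * max_modulus (Pfun p) r"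
    by (rule norm_coeff_le_max_norm_poly[OF r])
  moreover have "coeff q k = of_real A"
    by (simp add: q_def A_def coeff_sum power2_eq_square)
  \<comment> \<open>The coefficient A of \<open>q\<close> is the square of \<open>sqrt A\<close>, so
    one factor cancels unless A = 0, where the claim is trivial.\<close>
  ultimately have "sqrt A * (sqrt A * r ^ k) \<le> sqrt A * max_modulus (Pfun p) r"
    using A0 by (simp flip: mult.assoc)
  moreover have "0 \<le> max_modulus (Pfun p) r" using max_modulus_Pfun_pos[of r] r by simp
  ultimately show ?thesis
    unfolding A_def[symmetric] using A0 by (cases "A = 0") (auto simp: mult_le_cancel_left_pos)
qed

lemma summable_coeff: "summable (\<lambda>n. (coeff (p n) k)\<^sup>2)"
proof (rule summableI_nonneg_bounded)
  fix N
  show "(\<Sum>n<N. (coeff (p n) k)\<^sup>2) \<le> (max_modulus (Pfun p) 1)\<^sup>2"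
    using partial_cseq_le[where r = 1 and N = N and k = k] by (simp add: sqrt_le_D)
qed auto

lemma summable_coeff_shift: "summable (\<lambda>i. (coeff (p (k + i)) k)\<^sup>2)"
  using summable_iff_shift[of "\<lambda>n. (coeff (p n) k)\<^sup>2" k] summable_coeff[of k]
  by (simp add: add.commute)

text \<open>The terms with n < k vanish. Starting at 0 gives all k the same summation range, as
  Minkowski's inequality requires.\<close>

lemma cseq_eq: "cseq p k = sqrt (\<Sum>n. (coeff (p n) k)\<^sup>2)"
  unfolding cseq_def using suminf_split_initial_segment[OF summable_coeff[of k], of k]
  by (simp add: add.commute)

lemma partial_le_cseq: "sqrt (\<Sum>n<N. (coeff (p n) k)\<^sup>2) \<le> cseq p k"
  unfolding cseq_eq by (intro real_sqrt_le_mono sum_le_suminf summable_coeff) auto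

lemma leading_coeff_le_cseq: "coeff (p n) n \<le> cseq p n"
proof -
  have "coeff (p n) n \<le> sqrt (\<Sum>j<Suc n. (coeff (p j) n)\<^sup>2)"
    by (rule real_le_rsqrt) (simp add: sum_nonneg)
  also have "\<dots> \<le> cseq p n" by (rule partial_le_cseq)
  finally show ?thesis .
qed

lemma cseq_pos: "0 < cseq p n"
  using leading_coeff_pos leading_coeff_le_cseq by (rule less_le_trans)

lemma cseq_le:
  assumes "0 < r"
  shows "cseq p k * r ^ k \<le> max_modulus (Pfun p) r"
proof -
  have "(\<lambda>N. sqrt (\<Sum>n<N. (coeff (p n) k)\<^sup>2) * r ^ k) \<longlonglongrightarrow> cseq p k * r ^ k"
    unfolding cseq_eq by (intro tendsto_intros summable_LIMSEQ summable_coeff)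
  then show ?thesis by (rule LIMSEQ_le_const2) (use partial_cseq_le[OF assms] in auto)
qed

text \<open>Cauchy's estimate at radius 2r buys the factor 2^(-k), which makes the series for
  \<open>\<Phi>\<close> summable.\<close>

lemma cseq_le_geometric:
  assumes "0 < r"
  shows "cseq p k * r ^ k \<le> max_modulus (Pfun p) (2 * r) * (1 / 2) ^ k"
  using cseq_le[of "2 * r" k] assms by (simp add: power_mult_distrib field_simps)

lemma summable_cseq: "summable (\<lambda>k. cseq p k * r ^ k)"
proof (rule summable_comparison_test'[where N = 0])
  \<comment> \<open>The radius |r| + 1 is positive for every real r, including r = 0.\<close>
  show "summable (\<lambda>k. max_modulus (Pfun p) (2 * (\<bar>r\<bar> + 1)) * (1 / 2) ^ k)"
    by (intro summable_mult summable_geometric) simp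
  fix k
  have "norm (cseq p k * r ^ k) = cseq p k * \<bar>r\<bar> ^ k"
    using cseq_pos[of k] by (simp add: abs_mult power_abs)
  also have "\<dots> \<le> cseq p k * (\<bar>r\<bar> + 1) ^ k"
    using cseq_pos[of k] by (intro mult_left_mono power_mono) auto
  also have "\<dots> \<le> max_modulus (Pfun p) (2 * (\<bar>r\<bar> + 1)) * (1 / 2) ^ k"
    by (rule cseq_le_geometric) simp
  finally show "norm (cseq p k * r ^ k) \<le> max_modulus (Pfun p) (2 * (\<bar>r\<bar> + 1)) * (1 / 2) ^ k" .
qed

end

lemma L2_set_sum_le: "finite K \<Longrightarrow> L2_set (\<lambda>n. \<Sum>k\<in>K. f k n) A \<le> (\<Sum>k\<in>K. L2_set (f k) A)"
proof (induction K rule: finite_induct)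
  case empty
  then show ?case by (simp add: L2_set_def)
next
  case (insert k K)
  then show ?case
    using L2_set_triangle_ineq[of "f k" "\<lambda>n. \<Sum>k\<in>K. f k n" A] by simp
qed

section \<open>Power series with nonnegative coefficients\<close>

context
  fixes a :: "nat \<Rightarrow> real"
  assumes nonneg: "\<And>n. 0 \<le> a n"
    and summable: "\<And>r. summable (\<lambda>n. a n * r ^ n)"
begin

lemma summable_power_series: "summable (\<lambda>n. complex_of_real (a n) * z ^ n)"
  using summable[of "cmod z"] by - (rule summable_norm_cancel, simp add: norm_mult norm_power nonneg)

lemma norm_power_series_le: "cmod (\<Sum>n. of_real (a n) * z ^ n) \<le> (\<Sum>n. a n * cmod z ^ n)"
  using summable_norm[of "\<lambda>n. complex_of_real (a n) * z ^ n"] summable[of "cmod z"]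
  by (simp add: norm_mult norm_power nonneg)

text \<open>By the triangle inequality the modulus is largest at the point z = r of the positive
  axis.\<close>

lemma max_modulus_power_series:
  assumes r: "0 \<le> r"
  shows "max_modulus (\<lambda>z. \<Sum>n. of_real (a n) * z ^ n) r = (\<Sum>n. a n * r ^ n)"
  unfolding max_modulus_def
proof (rule cSup_eq_maximum)
  have "(\<Sum>n. of_real (a n) * complex_of_real r ^ n) = of_real (\<Sum>n. a n * r ^ n)"
    using suminf_of_real[OF summable[of r], where 'a = complex] by simp
  moreover have "0 \<le> (\<Sum>n. a n * r ^ n)"
    using r nonneg by (intro suminf_nonneg summable) auto
  ultimately show "(\<Sum>n. a n * r ^ n) \<in> (\<lambda>z. cmod (\<Sum>n. of_real (a n) * z ^ n)) ` cball 0 r"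
    using r by (intro image_eqI[of _ _ "of_real r"]) auto
  show "x \<le> (\<Sum>n. a n * r ^ n)" if x: "x \<in> (\<lambda>z. cmod (\<Sum>n. of_real (a n) * z ^ n)) ` cball 0 r" for x
  proof -
    obtain z where z: "cmod z \<le> r" "x = cmod (\<Sum>n. of_real (a n) * z ^ n)" using x by auto
    note z(2)
    also have "cmod (\<Sum>n. of_real (a n) * z ^ n) \<le> (\<Sum>n. a n * cmod z ^ n)"
      by (rule norm_power_series_le)
    also have "\<dots> \<le> (\<Sum>n. a n * r ^ n)"
      using nonneg z(1) by (intro suminf_le summable mult_left_mono power_mono) auto
    finally show ?thesis .
  qed
qed

lemma holomorphic_power_series: "(\<lambda>z. \<Sum>n. of_real (a n) * z ^ n) holomorphic_on UNIV"
proof -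
  have "((\<lambda>z. \<Sum>n. complex_of_real (a n) * z ^ n) has_field_derivative
      (\<Sum>n. diffs (\<lambda>n. complex_of_real (a n)) n * z ^ n)) (at z)" for z
    by (rule termdiffs_strong_converges_everywhere) (rule summable_power_series)
  then show ?thesis
    unfolding holomorphic_on_open[OF open_UNIV] by (intro ballI exI)
qed

end

lemma summable_power_series_mono:
  fixes a b :: "nat \<Rightarrow> real"
  assumes "\<And>n. 0 \<le> a n" "\<And>n. a n \<le> b n" "\<And>r. summable (\<lambda>n. b n * r ^ n)"
  shows "summable (\<lambda>n. a n * r ^ n)"
proof (rule summable_comparison_test'[where N = 0])
  show "summable (\<lambda>n. b n * \<bar>r\<bar> ^ n)" by (rule assms(3))
  show "norm (a n * r ^ n) \<le> b n * \<bar>r\<bar> ^ n" for n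
    using assms(1,2)[of n] by (simp add: abs_mult power_abs mult_right_mono)
qed

lemma max_modulus_power_series_mono:
  assumes "\<And>n. 0 \<le> a n" "\<And>n. a n \<le> b n" "\<And>r. summable (\<lambda>n. b n * r ^ n)" "0 \<le> r"
  shows "max_modulus (\<lambda>z. \<Sum>n. of_real (a n) * z ^ n) r \<le> max_modulus (\<lambda>z. \<Sum>n. of_real (b n) * z ^ n) r"
proof -
  note sa = summable_power_series_mono[OF assms(1-3)]
  have b: "0 \<le> b n" for n using assms(1,2)[of n] by linarith
  show ?thesis
    unfolding max_modulus_power_series[OF assms(1) sa assms(4)] max_modulus_power_series[OF b assms(3,4)]
    using assms by (intro suminf_le mult_right_mono sa) auto
qed

context indeterminate_moment_problem
begin

lemma max_modulus_Phifun: "0 \<le> r \<Longrightarrow> max_modulus (Phifun p) r = (\<Sum>n. cseq p n * r ^ n)"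
  unfolding Phifun_def using cseq_pos summable_cseq by (intro max_modulus_power_series) (auto simp: less_imp_le)

text \<open>The vector (P_n(z))_n is the sum over k of the vectors (\<open>coeff (p n) k\<close>
  z^k)_n, whose norms are at most c_k r^k. Minkowski's inequality is applied to truncations at N,
  followed by a limit.\<close>

lemma Pfun_le_Phifun:
  assumes z: "cmod z \<le> r"
  shows "cmod (Pfun p z) \<le> max_modulus (Phifun p) r"
proof -
  have r: "0 \<le> r" using z norm_ge_zero order_trans by blast
  have "sqrt (\<Sum>n<N. (cmod (poly (cpoly (p n)) z))\<^sup>2) \<le> (\<Sum>n. cseq p n * r ^ n)" for N
  proof -
    have le: "cmod (poly (cpoly (p n)) z) \<le> (\<Sum>k<N. \<bar>coeff (p n) k\<bar> * r ^ k)" if "n < N" for n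
    proof -
      have "poly (cpoly (p n)) z = (\<Sum>k\<le>n. of_real (coeff (p n) k) * z ^ k)"
        by (simp add: poly_altdef)
      \<comment> \<open>Zero coefficients pad every \<open>p n\<close> with n < N to the common
        range k < N.\<close>
      also have "\<dots> = (\<Sum>k<N. of_real (coeff (p n) k) * z ^ k)"
        using that by (intro sum.mono_neutral_left) auto
      finally have "cmod (poly (cpoly (p n)) z) \<le> (\<Sum>k<N. cmod (of_real (coeff (p n) k) * z ^ k))"
        by (simp only: norm_sum)
      also have "\<dots> \<le> (\<Sum>k<N. \<bar>coeff (p n) k\<bar> * r ^ k)"
        using z by (intro sum_mono) (auto simp: norm_mult norm_power intro!: mult_left_mono power_mono)
      finally show ?thesis .
    qed
    have "sqrt (\<Sum>n<N. (cmod (poly (cpoly (p n)) z))\<^sup>2) = L2_set (\<lambda>n. cmod (poly (cpoly (p n)) z)) {..<N}"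
      by (simp add: L2_set_def)
    also have "\<dots> \<le> L2_set (\<lambda>n. \<Sum>k<N. \<bar>coeff (p n) k\<bar> * r ^ k) {..<N}"
      using le by (intro L2_set_mono) auto
    also have "\<dots> \<le> (\<Sum>k<N. L2_set (\<lambda>n. \<bar>coeff (p n) k\<bar> * r ^ k) {..<N})"
      by (rule L2_set_sum_le) simp
    also have "\<dots> = (\<Sum>k<N. sqrt (\<Sum>n<N. (coeff (p n) k)\<^sup>2) * r ^ k)"
      using r by (simp add: L2_set_left_distrib[symmetric]) (simp add: L2_set_def)
    also have "\<dots> \<le> (\<Sum>k<N. cseq p k * r ^ k)"
      using r by (intro sum_mono mult_right_mono partial_le_cseq) auto
    also have "\<dots> \<le> (\<Sum>n. cseq p n * r ^ n)"
      using r cseq_pos by (intro sum_le_suminf summable_cseq) (auto simp: less_imp_le)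
    finally show ?thesis .
  qed
  moreover have "(\<lambda>N. sqrt (\<Sum>n<N. (cmod (poly (cpoly (p n)) z))\<^sup>2)) \<longlonglongrightarrow> cmod (Pfun p z)"
    unfolding norm_Pfun by (intro tendsto_intros summable_LIMSEQ summable_p)
  ultimately show ?thesis
    unfolding max_modulus_Phifun[OF r] by (intro LIMSEQ_le_const2) auto
qed

lemma max_modulus_Pfun_le_Phifun: "0 \<le> r \<Longrightarrow> max_modulus (Pfun p) r \<le> max_modulus (Phifun p) r"
  unfolding max_modulus_def[of "Pfun p"] by (rule cSUP_least) (auto intro: Pfun_le_Phifun)

lemma max_modulus_Phifun_le_Pfun:
  assumes "0 < r"
  shows "max_modulus (Phifun p) r \<le> 2 * max_modulus (Pfun p) (2 * r)"
proof -
  have "(\<Sum>n. cseq p n * r ^ n) \<le> (\<Sum>n. max_modulus (Pfun p) (2 * r) * (1 / 2) ^ n)"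
    using assms by (intro suminf_le cseq_le_geometric summable_cseq summable_mult summable_geometric) auto
  also have "\<dots> = 2 * max_modulus (Pfun p) (2 * r)"
    by (subst suminf_mult) (auto simp: suminf_geometric)
  finally show ?thesis using assms by (simp add: max_modulus_Phifun)
qed

end

section \<open>Growth orders\<close>

text \<open>An arbitrarily small loss in the exponent does not change an infimum; this slack absorbs
  the constants \<open>C\<close> and \<open>k\<close> below.\<close>

lemma Inf_ereal_le_if_shifted:
  assumes "\<And>a b. P a \<Longrightarrow> 0 < a \<Longrightarrow> a < b \<Longrightarrow> Q b"
  shows "Inf {ereal a | a. 0 < a \<and> Q a} \<le> Inf {ereal a | a. 0 < a \<and> P a}"
proof (rule Inf_greatest)
  fix x assume "x \<in> {ereal a | a. 0 < a \<and> P a}"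
  then obtain a where a: "x = ereal a" "0 < a" "P a" by auto
  show "Inf {ereal a | a. 0 < a \<and> Q a} \<le> x"
  proof (rule ereal_le_epsilon2)
    fix e :: real assume "0 < e"
    then have "ereal (a + e) \<in> {ereal a | a. 0 < a \<and> Q a}"
      using a assms[of a "a + e"] by auto
    then have "Inf {ereal a | a. 0 < a \<and> Q a} \<le> ereal (a + e)" by (rule Inf_lower)
    then show "Inf {ereal a | a. 0 < a \<and> Q a} \<le> x + ereal e" using a by simp
  qed
qed

context
  fixes f g :: "complex \<Rightarrow> complex" and C k :: real
  assumes pos: "\<forall>\<^sub>F r in at_top. 0 < max_modulus f r"
    and le: "\<forall>\<^sub>F r in at_top. max_modulus f r \<le> C * max_modulus g (k * r)"
    and C: "1 \<le> C" and k: "1 \<le> k"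
begin

lemma growth_order_le: "growth_order f \<le> growth_order g"
  unfolding growth_order_def
proof (rule Inf_ereal_le_if_shifted)
  fix a b :: real
  assume ev: "\<forall>\<^sub>F r in at_top. ln (max_modulus g r) \<le> r powr a" and a: "0 < a" "a < b"
  have "filterlim (\<lambda>r. k * r) at_top at_top" using k by real_asymp
  then have "\<forall>\<^sub>F r in at_top. ln (max_modulus g (k * r)) \<le> (k * r) powr a"
    using ev by (rule eventually_compose_filterlim[rotated])
  moreover have "\<forall>\<^sub>F r in at_top. ln C + (k * r) powr a \<le> r powr b"
    using a k by real_asymp
  ultimately show "\<forall>\<^sub>F r in at_top. ln (max_modulus f r) \<le> r powr b"
    using pos le
  proof eventually_elim
    case (elim r)
    \<comment> \<open>Positivity passes from f to g through the bound, so the logarithm of the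
      product splits.\<close>
    then have g: "0 < max_modulus g (k * r)" using C by (smt (verit) zero_less_mult_pos)
    have "ln (max_modulus f r) \<le> ln (C * max_modulus g (k * r))"
      using elim C g by (subst ln_le_cancel_iff) auto
    also have "\<dots> = ln C + ln (max_modulus g (k * r))" using C g by (simp add: ln_mult)
    finally show ?case using elim by linarith
  qed
qed

lemma log_order_le: "log_order f \<le> log_order g"
  unfolding log_order_def
proof (rule Inf_ereal_le_if_shifted)
  fix a b :: real
  assume ev: "\<forall>\<^sub>F r in at_top. max_modulus g r \<le> r powr (ln r powr a)" and a: "0 < a" "a < b"
  have "filterlim (\<lambda>r. k * r) at_top at_top" using k by real_asymp
  then have "\<forall>\<^sub>F r in at_top. max_modulus g (k * r) \<le> (k * r) powr (ln (k * r) powr a)"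
    using ev by (rule eventually_compose_filterlim[rotated])
  moreover have "\<forall>\<^sub>F r in at_top. C * (k * r) powr (ln (k * r) powr a) \<le> r powr (ln r powr b)"
  proof -
    \<comment> \<open>The claim after taking logarithms: essentially (ln r)^(a+1) against (ln
      r)^(b+1).\<close>
    have "\<forall>\<^sub>F r in at_top. ln C + ln (k * r) powr a * ln (k * r) \<le> ln r powr b * ln r"
      using a k by real_asymp
    moreover have "\<forall>\<^sub>F r in at_top. (1::real) < r" by (rule eventually_gt_at_top)
    ultimately show ?thesis
    proof eventually_elim
      case (elim r)
      have "C * (k * r) powr (ln (k * r) powr a) = exp (ln C + ln (k * r) powr a * ln (k * r))"
        using elim C k by (simp add: powr_def exp_add)
      also have "\<dots> \<le> exp (ln r powr b * ln r)" using elim by simp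
      also have "\<dots> = r powr (ln r powr b)" using elim by (simp add: powr_def)
      finally show ?case .
    qed
  qed
  ultimately show "\<forall>\<^sub>F r in at_top. max_modulus f r \<le> r powr (ln r powr b)"
    using le
  proof eventually_elim
    case (elim r)
    then show ?case using C by (smt (verit) mult_left_mono)
  qed
qed

lemma double_log_order_le: "double_log_order f \<le> double_log_order g"
  unfolding double_log_order_def
proof (rule Inf_ereal_le_if_shifted)
  fix a b :: real
  assume ev: "\<forall>\<^sub>F r in at_top. max_modulus g r \<le> r powr (ln (ln r) powr a)" and a: "0 < a" "a < b"
  have "filterlim (\<lambda>r. k * r) at_top at_top" using k by real_asymp
  then have "\<forall>\<^sub>F r in at_top. max_modulus g (k * r) \<le> (k * r) powr (ln (ln (k * r)) powr a)"
    using ev by (rule eventually_compose_filterlim[rotated])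
  moreover have "\<forall>\<^sub>F r in at_top. C * (k * r) powr (ln (ln (k * r)) powr a) \<le> r powr (ln (ln r) powr b)"
  proof -
    \<comment> \<open>In logarithmic form, ln(kr)/ln r tends to 1, while the iterated logarithm with
      exponent b outgrows the one with exponent a.\<close>
    have "\<forall>\<^sub>F r in at_top. ln C + ln (ln (k * r)) powr a * ln (k * r) \<le> ln (ln r) powr b * ln r"
      using a k by real_asymp
    moreover have "\<forall>\<^sub>F r in at_top. (1::real) < r" by (rule eventually_gt_at_top)
    ultimately show ?thesis
    proof eventually_elim
      case (elim r)
      have "C * (k * r) powr (ln (ln (k * r)) powr a) = exp (ln C + ln (ln (k * r)) powr a * ln (k * r))"
        using elim C k by (simp add: powr_def exp_add)
      also have "\<dots> \<le> exp (ln (ln r) powr b * ln r)" using elim by simp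
      also have "\<dots> = r powr (ln (ln r) powr b)" using elim by (simp add: powr_def)
      finally show ?case .
    qed
  qed
  ultimately show "\<forall>\<^sub>F r in at_top. max_modulus f r \<le> r powr (ln (ln r) powr b)"
    using le
  proof eventually_elim
    case (elim r)
    then show ?case using C by (smt (verit) mult_left_mono)
  qed
qed

end

lemma max_modulus_power_series_pos:
  assumes "\<And>n. 0 < a n" "\<And>r. summable (\<lambda>n. a n * r ^ n)" "0 \<le> r"
  shows "0 < max_modulus (\<lambda>z. \<Sum>n. of_real (a n) * z ^ n) r"
proof -
  have "(\<Sum>n<1. a n * r ^ n) \<le> (\<Sum>n. a n * r ^ n)"
    using assms by (intro sum_le_suminf) (auto simp: less_imp_le)
  then show ?thesis
    using assms max_modulus_power_series[of a r] by (simp add: less_imp_le order.strict_trans2[of 0 "a 0"])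
qed

lemma orders_mono:
  assumes "\<And>r. 0 < r \<Longrightarrow> 0 < max_modulus f r"
    and "\<And>r. 0 < r \<Longrightarrow> max_modulus f r \<le> C * max_modulus g (k * r)" "1 \<le> C" "1 \<le> k"
  shows "growth_order f \<le> growth_order g" "log_order f \<le> log_order g"
    "double_log_order f \<le> double_log_order g"
proof -
  have 1: "\<forall>\<^sub>F r in at_top. 0 < max_modulus f r"
    using assms(1) by (rule eventually_mono[OF eventually_gt_at_top[of 0]])
  have 2: "\<forall>\<^sub>F r in at_top. max_modulus f r \<le> C * max_modulus g (k * r)"
    using assms(2) by (rule eventually_mono[OF eventually_gt_at_top[of 0]])
  show "growth_order f \<le> growth_order g" "log_order f \<le> log_order g"
    "double_log_order f \<le> double_log_order g"
    using growth_order_le[OF 1 2 assms(3,4)] log_order_le[OF 1 2 assms(3,4)]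
      double_log_order_le[OF 1 2 assms(3,4)] .
qed

section \<open>Comparison of L, H and \<open>\<Phi>\<close>\<close>

context indeterminate_moment_problem
begin

lemma even_moment_pos: "0 < s (2 * n)"
  using moment_times_leading_coeff[of n] leading_coeff_pos[of n]
  by (smt (verit) mult_nonpos_nonneg zero_le_power2)

lemma inverse_sqrt_moment_le: "1 / sqrt (s (2 * n)) \<le> coeff (p n) n"
proof -
  have "1 \<le> sqrt (s (2 * n) * (coeff (p n) n)\<^sup>2)"
    using moment_times_leading_coeff[of n] by simp
  then show ?thesis
    using even_moment_pos[of n] leading_coeff_pos[of n] by (simp add: real_sqrt_mult field_simps)
qed

lemma Lfun_eq: "Lfun s = (\<lambda>z. \<Sum>n. of_real (1 / sqrt (s (2 * n))) * z ^ n)"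
  by (simp add: Lfun_def fun_eq_iff)

lemma coefficients_nonneg: "0 \<le> 1 / sqrt (s (2 * n))" "0 \<le> coeff (p n) n" "0 \<le> cseq p n"
  using even_moment_pos[of n] leading_coeff_pos[of n] cseq_pos[of n] by auto

lemma summable_leading_coeff: "summable (\<lambda>n. coeff (p n) n * r ^ n)"
  by (rule summable_power_series_mono[OF coefficients_nonneg(2) leading_coeff_le_cseq summable_cseq])

lemma summable_inverse_sqrt_moment: "summable (\<lambda>n. 1 / sqrt (s (2 * n)) * r ^ n)"
  by (rule summable_power_series_mono[OF coefficients_nonneg(1) inverse_sqrt_moment_le summable_leading_coeff])

lemma max_modulus_Hfun_le_Phifun: "0 \<le> r \<Longrightarrow> max_modulus (Hfun p) r \<le> max_modulus (Phifun p) r"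
  unfolding Hfun_def[abs_def] Phifun_def[abs_def]
  by (rule max_modulus_power_series_mono[OF coefficients_nonneg(2) leading_coeff_le_cseq summable_cseq])

lemma max_modulus_Lfun_le_Hfun: "0 \<le> r \<Longrightarrow> max_modulus (Lfun s) r \<le> max_modulus (Hfun p) r"
  unfolding Hfun_def[abs_def] Lfun_eq
  by (rule max_modulus_power_series_mono[OF coefficients_nonneg(1) inverse_sqrt_moment_le summable_leading_coeff])

lemma max_modulus_Lfun_pos: "0 \<le> r \<Longrightarrow> 0 < max_modulus (Lfun s) r"
  unfolding Lfun_eq using even_moment_pos summable_inverse_sqrt_moment by (intro max_modulus_power_series_pos) auto

lemma max_modulus_Hfun_pos: "0 \<le> r \<Longrightarrow> 0 < max_modulus (Hfun p) r"
  using max_modulus_Lfun_pos max_modulus_Lfun_le_Hfun by (rule less_le_trans)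

lemma max_modulus_Phifun_pos: "0 \<le> r \<Longrightarrow> 0 < max_modulus (Phifun p) r"
  using max_modulus_Hfun_pos max_modulus_Hfun_le_Phifun by (rule less_le_trans)

lemma moment_times_leading_coeff_le: "s (2 * n) * (coeff (p n) n)\<^sup>2 \<le> (cseq p n)\<^sup>2 * s (2 * n)"
  using even_moment_pos[of n]
  by (subst mult.commute) (intro mult_right_mono power_mono leading_coeff_le_cseq coefficients_nonneg(2), simp)

end

text \<open>The opening conjuncts certify that the infinite sums in the definitions are genuine
  limits and that L, H and \<open>\<Phi>\<close> are entire.\<close>

theorem proposition7p1:
  fixes \<mu> :: "real measure" and s :: "nat \<Rightarrow> real" and p :: "nat \<Rightarrow> real poly"
  assumes "prob_space \<mu>"
    and "infinite (measure_support \<mu>)"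
    and "has_moments \<mu> s"
    and "indeterminate s"
    and "orthonormal_polynomials \<mu> p"
  shows
    "((\<forall>z. summable (\<lambda>n. (cmod (poly (map_poly of_real (p n)) z))\<^sup>2))
      \<and> (\<forall>k. summable (\<lambda>i. (coeff (p (k + i)) k)\<^sup>2))
      \<and> (\<forall>z::complex. summable (\<lambda>n. z ^ n / of_real (sqrt (s (2 * n)))))
      \<and> (\<forall>z::complex. summable (\<lambda>n. of_real (coeff (p n) n) * z ^ n))
      \<and> (\<forall>z::complex. summable (\<lambda>n. of_real (cseq p n) * z ^ n))
      \<and> Lfun s holomorphic_on UNIV \<and> Hfun p holomorphic_on UNIV \<and> Phifun p holomorphic_on UNIV)
     \<and>
     (\<forall>n. 1 \<le> s (2 * n) * (coeff (p n) n)\<^sup>2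
        \<and> s (2 * n) * (coeff (p n) n)\<^sup>2 \<le> (cseq p n)\<^sup>2 * s (2 * n))
     \<and>
     (\<forall>r\<ge>0. max_modulus (Lfun s) r \<le> max_modulus (Hfun p) r
        \<and> max_modulus (Hfun p) r \<le> max_modulus (Phifun p) r)
     \<and>
     (growth_order (Lfun s) \<le> growth_order (Hfun p)
      \<and> growth_order (Hfun p) \<le> growth_order (Phifun p)
      \<and> growth_order (Phifun p) = problem_order p)
     \<and>
     (problem_order p = 0 \<longrightarrow>
        log_order (Lfun s) \<le> log_order (Hfun p)
      \<and> log_order (Hfun p) \<le> log_order (Phifun p)
      \<and> log_order (Phifun p) = problem_log_order p)
     \<and>
     (problem_log_order p = 0 \<longrightarrow>
        double_log_order (Lfun s) \<le> double_log_order (Hfun p)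
      \<and> double_log_order (Hfun p) \<le> double_log_order (Phifun p)
      \<and> double_log_order (Phifun p) = problem_double_log_order p)"
proof -
  have "s 0 = 1"
    using assms(1,3) prob_space.prob_space[of \<mu>] by (auto simp: has_moments_def dest: spec[of _ 0])
  then interpret indeterminate_moment_problem \<mu> s p
    using assms(3-5)
    by (simp add: indeterminate_moment_problem_def indeterminate_moment_problem_axioms_def moment_problem_def)
  have L: "growth_order (Lfun s) \<le> growth_order (Hfun p)" "log_order (Lfun s) \<le> log_order (Hfun p)"
      "double_log_order (Lfun s) \<le> double_log_order (Hfun p)"
    using max_modulus_Lfun_pos max_modulus_Lfun_le_Hfun by (auto intro!: orders_mono[where C = 1 and k = 1])
  have H: "growth_order (Hfun p) \<le> growth_order (Phifun p)" "log_order (Hfun p) \<le> log_order (Phifun p)"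
      "double_log_order (Hfun p) \<le> double_log_order (Phifun p)"
    using max_modulus_Hfun_pos max_modulus_Hfun_le_Phifun by (auto intro!: orders_mono[where C = 1 and k = 1])
  \<comment> \<open>The constants 2 and 2 are those of \<open>max_modulus_Phifun_le_Pfun\<close>:
    the sum of the geometric series and the doubled radius.\<close>
  have P1: "growth_order (Phifun p) \<le> growth_order (Pfun p)" "log_order (Phifun p) \<le> log_order (Pfun p)"
      "double_log_order (Phifun p) \<le> double_log_order (Pfun p)"
    using max_modulus_Phifun_pos max_modulus_Phifun_le_Pfun by (auto intro!: orders_mono[where C = 2 and k = 2])
  have P2: "growth_order (Pfun p) \<le> growth_order (Phifun p)" "log_order (Pfun p) \<le> log_order (Phifun p)"
      "double_log_order (Pfun p) \<le> double_log_order (Phifun p)"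
    using max_modulus_Pfun_pos max_modulus_Pfun_le_Phifun by (auto intro!: orders_mono[where C = 1 and k = 1])
  have "summable (\<lambda>n. z ^ n / complex_of_real (sqrt (s (2 * n))))" for z
    using summable_power_series[OF coefficients_nonneg(1) summable_inverse_sqrt_moment, of z] by simp
  moreover have "Lfun s holomorphic_on UNIV"
    unfolding Lfun_eq by (rule holomorphic_power_series[OF coefficients_nonneg(1) summable_inverse_sqrt_moment])
  moreover have "Hfun p holomorphic_on UNIV"
    unfolding Hfun_def[abs_def] by (rule holomorphic_power_series[OF coefficients_nonneg(2) summable_leading_coeff])
  moreover have "Phifun p holomorphic_on UNIV"
    unfolding Phifun_def[abs_def] by (rule holomorphic_power_series[OF coefficients_nonneg(3) summable_cseq])
  moreover note summable_p summable_coeff_shift moment_times_leading_coeff moment_times_leading_coeff_le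
    summable_power_series[OF coefficients_nonneg(2) summable_leading_coeff] summable_power_series[OF coefficients_nonneg(3) summable_cseq]
    max_modulus_Lfun_le_Hfun max_modulus_Hfun_le_Phifun L H P1 P2
  ultimately show ?thesis
    unfolding problem_order_def problem_log_order_def problem_double_log_order_def
    by (intro conjI allI impI antisym) assumption+
qed

end
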